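(* Let $n=2m+1\ge 7$ be odd, let $V$ be as described in the context, and let $Z$ be standard normal. Then $$\sup_{z\in\mathbb{R}}\left|P\left(\frac{V-n/2}{\sigma_V}\le z\right)-P(Z\le z)\right|\le\frac{n}{2\sigma_V^2}\overline{\Delta}_1+1.64\frac{n}{\sigma_V^3}+\frac{2}{\sigma_V},$$ where $\sigma_V^2=\frac n4(1-\overline{\lambda}_{n,2,\mathbf{n}})+\frac{n^2}{4}\overline{\lambda}_{n,2,\mathbf{n}}$ and $\overline{\Delta}_1=\frac{1}{\sqrt n}+\frac{1}{2\sqrt2}e^{-n/4}$.
   Context: Standard lightbulb process: $n$ bulbs, all initially off, $n$ stages; at stage $r$ a uniformly random subset of exactly $r$ bulbs is toggled, independently across stages; switch variables $X_{rj}\in\{0,1\}$ ($1$ iff bulb $j$ toggled at stage $r$). For $n=2m+1$: given $\mathbf{X}$, let $B_m$ be uniform on $\{j:X_{mj}=0\}$ and $B_{m+1}$ uniform on $\{j:X_{m+1,j}=1\}$; let $C_m,C_{m+1}$ be independent symmetric Bernoulli variables independent of $\mathbf{X},B_m,B_{m+1}$; set $V_{rj}=X_{rj}$ except $V_{m,B_m}=C_m$ and $V_{m+1,B_{m+1}}=C_{m+1}$; $V_j=(\sum_{r=1}^nV_{rj})\bmod 2$, $V=\sum_{j=1}^nV_j$. With $(n)_t=n(n-1)\cdots(n-t+1)$, $\lambda_{n,b,s}=\sum_{t=0}^b\binom bt(-2)^t\frac{(s)_t}{(n)_t}$, and $\overline{\lambda}_{n,2,\mathbf{n}}=\Big(\prod_{s\in\{1,\dots,n\}\setminus\{m,m+1\}}\lambda_{n,2,s}\Big)\Big(\tfrac12(\lambda_{n,2,m}+\lambda_{n,2,m+1})\Big)^2$.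 *)

theory Defs
  imports "HOL-Probability.Probability"
begin

text \<open>Lightbulb process with n bulbs labelled 1..n and stages 1..n.
  A configuration of switches is a function S from stages to sets of bulbs:
  S r is the set of bulbs toggled at stage r, i.e. X_rj = 1 iff j \<in> S r.\<close>

definition switch_pmf :: "nat \<Rightarrow> (nat \<Rightarrow> nat set) pmf" where
  "switch_pmf n = Pi_pmf {1..n} {} (\<lambda>r. pmf_of_set {T. T \<subseteq> {1..n} \<and> card T = r})"

definition modify_switch :: "nat \<Rightarrow> (nat \<Rightarrow> nat set) \<Rightarrow> nat \<Rightarrow> nat \<Rightarrow> bool \<Rightarrow> bool \<Rightarrow> nat \<Rightarrow> nat set" where
  "modify_switch m S b b' c c' r =
     (if r = m then (if c then insert b (S r) else S r - {b})
      else if r = m + 1 then (if c' then insert b' (S r) else S r - {b'})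
      else S r)"

definition bulbs_on :: "nat \<Rightarrow> (nat \<Rightarrow> nat set) \<Rightarrow> nat" where
  "bulbs_on n W = card {j \<in> {1..n}. odd (card {r \<in> {1..n}. j \<in> W r})}"

definition V_pmf :: "nat \<Rightarrow> nat pmf" where
  "V_pmf m = (let n = 2 * m + 1 in
     do { S \<leftarrow> switch_pmf n;
          b \<leftarrow> pmf_of_set ({1..n} - S m);
          b' \<leftarrow> pmf_of_set (S (m + 1));
          c \<leftarrow> bernoulli_pmf (1/2);
          c' \<leftarrow> bernoulli_pmf (1/2);
          return_pmf (bulbs_on n (modify_switch m S b b' c c')) })"

definition ffall :: "nat \<Rightarrow> nat \<Rightarrow> real" where
  "ffall s t = (\<Prod>i<t. real s - real i)"

definition lam :: "nat \<Rightarrow> nat \<Rightarrow> nat \<Rightarrow> real" where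
  "lam n b s = (\<Sum>t = 0..b. real (b choose t) * (-2) ^ t * ffall s t / ffall n t)"

definition lam_bar :: "nat \<Rightarrow> nat \<Rightarrow> real" where
  "lam_bar n m = (\<Prod>s \<in> {1..n} - {m, m + 1}. lam n 2 s) * ((lam n 2 m + lam n 2 (m + 1)) / 2) ^ 2"

definition sigmaV :: "nat \<Rightarrow> nat \<Rightarrow> real" where
  "sigmaV n m = sqrt (real n / 4 * (1 - lam_bar n m) + (real n)^2 / 4 * lam_bar n m)"

definition Delta1_bar :: "nat \<Rightarrow> real" where
  "Delta1_bar n = 1 / sqrt (real n) + 1 / (2 * sqrt 2) * exp (- real n / 4)"

definition Phi :: "real \<Rightarrow> real" where
  "Phi z = measure (density lborel std_normal_density) {..z}"

end

theory Submission
  imports Defs "HOL-Real_Asymp.Real_Asymp"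
begin

text \<open>
  The set of lit bulbs is a symmetric difference of independent random sets, so its Walsh--Fourier
  coefficients factor over the stages. Exchanging a bulb inside a character's support with one
  outside it shows that stage \<open>s\<close> contributes a factor of modulus at most
  \<open>1 - 2 s (n - s) / (n (n - 1))\<close>; the full character, the only one without such an exchange, is
  killed by the fair coins. Parseval for the two stages \<open>m - 1\<close> and \<open>m + 2\<close> keeps the sum over the
  \<open>2 ^ n\<close> characters polynomial, so \<open>V\<close> is within \<open>2 (n + 1) exp (3 - (n + 1) / 3)\<close> of the
  symmetric binomial law in total variation.

  For the symmetric binomial law Stein's identity compares the solution \<open>f\<close> of Stein's equation at
  neighbouring lattice points. Since \<open>w f(w)\<close> is increasing with total variation at most 1 and every
  atom is at most \<open>1 / sqrt n\<close>, the Kolmogorov distance is at most \<open>3 / (2 sqrt n)\<close>.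
  The claimed bound exceeds 1 for \<open>n \<le> 100\<close>, and for larger \<open>n\<close> its term \<open>2 / \<sigma>\<close> alone suffices.
\<close>

subsection \<open>The standard normal distribution\<close>

lemma real_distribution_std_normal: "real_distribution (density lborel std_normal_density)"
proof -
  interpret prob_space "density lborel std_normal_density"
    by (rule prob_space_normal_density) simp
  show ?thesis by unfold_locales simp
qed

lemma Phi_eq_cdf: "Phi z = cdf (density lborel std_normal_density) z"
  by (simp add: Phi_def cdf_def)

lemma Phi_nonneg: "0 \<le> Phi z" and Phi_le_1: "Phi z \<le> 1"
  unfolding Phi_eq_cdf
  using real_distribution.cdf_bounded_prob[OF real_distribution_std_normal]
  by (auto simp: cdf_def)

lemma Phi_at_top: "(Phi \<longlongrightarrow> 1) at_top"
  using real_distribution.cdf_lim_at_top_prob[OF real_distribution_std_normal]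
  by (simp add: Phi_eq_cdf[abs_def])

lemma Phi_at_bot: "(Phi \<longlongrightarrow> 0) at_bot"
  using finite_borel_measure.cdf_lim_at_bot[OF real_distribution.finite_borel_measure_M[OF real_distribution_std_normal]]
  by (simp add: Phi_eq_cdf[abs_def])

lemma continuous_on_std_normal_density: "continuous_on A std_normal_density"
  unfolding std_normal_density_def by (intro continuous_intros) auto

lemma Phi_diff:
  assumes "a \<le> b"
  shows "Phi b - Phi a = integral {a..b} std_normal_density"
proof -
  interpret real_distribution "density lborel std_normal_density"
    by (rule real_distribution_std_normal)
  have int: "set_integrable lborel {a..b} std_normal_density"
    by (rule borel_integrable_atLeastAtMost') (rule continuous_on_std_normal_density)
  have "Phi b - Phi a = measure (density lborel std_normal_density) {a<..b}"
  proof (cases "a = b")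
    case False
    then show ?thesis using cdf_diff_eq[of a b] assms by (simp add: Phi_eq_cdf)
  qed simp
  also have "\<dots> = (LBINT x:{a<..b}. std_normal_density x)"
    by (simp add: measure_def emeasure_density set_lebesgue_integral_def integral_eq_nn_integral
        mult.commute ennreal_mult' ennreal_indicator)
  also have "\<dots> = (LBINT x:{a..b}. std_normal_density x)"
  proof (rule set_integral_cong_set)
    have "AE x in lborel. x \<noteq> a" by (rule AE_lborel_singleton)
    then show "AE x in lborel. (x \<in> {a..b}) = (x \<in> {a<..b})" by eventually_elim auto
  qed (auto simp: set_borel_measurable_def)
  also have "\<dots> = integral {a..b} std_normal_density"
    using int by (rule set_borel_integral_eq_integral)
  finally show ?thesis .
qed

lemma Phi_has_real_derivative: "(Phi has_real_derivative std_normal_density x) (at x)"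
proof -
  have "((\<lambda>u. integral {x - 1..u} std_normal_density) has_real_derivative std_normal_density x)
      (at x within {x - 1..x + 1})"
    by (rule integral_has_real_derivative) (auto intro: continuous_on_std_normal_density)
  then have "((\<lambda>u. integral {x - 1..u} std_normal_density) has_real_derivative std_normal_density x)
      (at x)"
    by (subst (asm) at_within_interior) (auto simp: interior_atLeastAtMost_real)
  then have "((\<lambda>u. Phi (x - 1) + integral {x - 1..u} std_normal_density)
      has_real_derivative std_normal_density x) (at x)"
    by (auto intro!: derivative_eq_intros)
  moreover have "eventually (\<lambda>u. u \<in> {x-1<..<x+1}) (nhds x)"
    by (rule eventually_nhds_in_open) auto
  then have "\<forall>\<^sub>F u in nhds x. Phi (x - 1) + integral {x - 1..u} std_normal_density = Phi u"
    by eventually_elim (auto simp: Phi_diff[symmetric])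
  ultimately show ?thesis
    by (subst (asm) DERIV_cong_ev[OF refl _ refl]) auto
qed

lemma std_normal_density_has_real_derivative:
  "(std_normal_density has_real_derivative - x * std_normal_density x) (at x)"
  unfolding std_normal_density_def
  by (rule derivative_eq_intros refl | simp)+

lemma std_normal_density_pos: "0 < std_normal_density x"
  by (rule normal_density_pos) simp

text \<open>The derivative of \<open>Phi x + Phi (- x)\<close> vanishes because the density is even;
  the constant is read off from the limits at infinity.\<close>

lemma Phi_minus: "Phi (- x) = 1 - Phi x"
proof -
  have "((\<lambda>x. Phi x + Phi (- x)) has_real_derivative 0) (at x)" for x
    by (rule derivative_eq_intros Phi_has_real_derivative
         DERIV_chain2[where f = Phi and g = uminus] refl)+ (simp add: std_normal_density_def)
  then have const: "(\<lambda>y. Phi y + Phi (- y)) = (\<lambda>y. Phi x + Phi (- x))"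
    by (intro ext DERIV_isconst_all[of "\<lambda>x. Phi x + Phi (- x)"]) auto
  have "((\<lambda>y. Phi y + Phi (- y)) \<longlongrightarrow> 1 + 0) at_top"
    by (intro tendsto_add Phi_at_top filterlim_compose[OF Phi_at_bot] filterlim_uminus_at_bot_at_top)
  then have "Phi x + Phi (- x) = 1 + 0"
    unfolding const
    by (intro tendsto_unique[OF _ tendsto_const]) auto
  then show ?thesis by simp
qed

text \<open>After division by \<open>1 + x\<^sup>2\<close> the right side minus the left tends to 0
  at infinity and is strictly decreasing, hence positive. This is the sign condition behind
  \<open>mult_mills_mono\<close>.\<close>

lemma normal_tail_lower: "x * std_normal_density x \<le> (1 + x\<^sup>2) * (1 - Phi x)"
proof -
  let ?h = "\<lambda>x. (1 - Phi x) - x * std_normal_density x / (1 + x\<^sup>2)"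
  have nz: "1 + x\<^sup>2 \<noteq> (0::real)" for x by (metis add_pos_nonneg less_irrefl zero_less_one zero_le_power2)
  have "0 < ?h x"
  proof (rule DERIV_neg_imp_decreasing_at_top[where f = ?h])
    fix y :: real
    have num: "(std_normal_density y - y * std_normal_density y * y) * (1 + y\<^sup>2)
          - y * std_normal_density y * (2 * y) = (2 - (1 + y\<^sup>2)\<^sup>2) * std_normal_density y"
      by (simp add: power2_eq_square algebra_simps)
    \<comment> \<open>Together with \<open>num\<close> this cancels every multiple of the density
      except \<open>2 * p / q\<^sup>2\<close>, so the derivative is negative for every real
      \<open>y\<close>.\<close>
    have alg: "- p - (2 - q\<^sup>2) * p / (q * q) = - (2 * p / q\<^sup>2)" if "q \<noteq> 0" for p q :: real
      using that by (simp add: field_simps power2_eq_square)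
    have "(?h has_real_derivative - 2 * std_normal_density y / (1 + y\<^sup>2)\<^sup>2) (at y)"
      by (auto intro!: derivative_eq_intros Phi_has_real_derivative
          std_normal_density_has_real_derivative simp: nz num alg[OF nz])
    moreover have "- 2 * std_normal_density y / (1 + y\<^sup>2)\<^sup>2 < 0"
      using nz[of y] std_normal_density_pos[of y] by (simp add: divide_simps)
    ultimately show "\<exists>d. (?h has_real_derivative d) (at y) \<and> d < 0" by blast
  next
    have "((\<lambda>x. x * std_normal_density x / (1 + x\<^sup>2)) \<longlongrightarrow> 0) at_top"
      unfolding std_normal_density_def by real_asymp
    then have "(?h \<longlongrightarrow> (1 - 1) - 0) at_top"
      by (intro tendsto_diff tendsto_const Phi_at_top)
    then show "(?h \<longlongrightarrow> 0) at_top" by simp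
  qed
  then show ?thesis using nz[of x] add_pos_nonneg[of 1 "x\<^sup>2"] by (simp add: field_simps)
qed

text \<open>For \<open>x \<le> 0\<close> the left side is at most 0. For positive \<open>x\<close>
  divide by \<open>x\<close>: the density over \<open>x\<close> minus the tail decreases to 0 at
  infinity.\<close>

lemma normal_tail_upper: "x * (1 - Phi x) \<le> std_normal_density x"
proof (cases "x \<le> 0")
  case True
  then have "x * (1 - Phi x) \<le> 0" using Phi_le_1[of x] by (simp add: mult_le_0_iff)
  then show ?thesis using std_normal_density_pos[of x] by simp
next
  case False
  let ?h = "\<lambda>x. std_normal_density x / x - (1 - Phi x)"
  have "0 < ?h x"
  proof (rule DERIV_neg_imp_decreasing_at_top[where f = ?h])
    fix y assume "x \<le> y"
    then have y: "y > 0" using False by simp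
    have "(?h has_real_derivative - std_normal_density y / y\<^sup>2) (at y)"
      using y by (auto intro!: derivative_eq_intros Phi_has_real_derivative
          std_normal_density_has_real_derivative simp: field_simps power2_eq_square)
    moreover have "- std_normal_density y / y\<^sup>2 < 0"
      using y std_normal_density_pos[of y] by simp
    ultimately show "\<exists>d. (?h has_real_derivative d) (at y) \<and> d < 0" by blast
  next
    have "((\<lambda>x. std_normal_density x / x) \<longlongrightarrow> 0) at_top"
      unfolding std_normal_density_def by real_asymp
    then have "(?h \<longlongrightarrow> 0 - (1 - 1)) at_top"
      by (intro tendsto_diff tendsto_const Phi_at_top)
    then show "(?h \<longlongrightarrow> 0) at_top" by simp
  qed
  then show ?thesis using False by (simp add: field_simps)
qed

subsection \<open>Mills' ratio and Stein's equation\<close>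

definition mills :: "real \<Rightarrow> real" where
  "mills x = (1 - Phi x) / std_normal_density x"

lemma mills_has_real_derivative: "(mills has_real_derivative x * mills x - 1) (at x)"
proof -
  have nz: "std_normal_density x \<noteq> 0" using std_normal_density_pos[of x] by simp
  have "((\<lambda>x. (1 - Phi x) / std_normal_density x) has_real_derivative x * mills x - 1) (at x)"
    using nz by (auto intro!: derivative_eq_intros Phi_has_real_derivative
        std_normal_density_has_real_derivative simp: mills_def field_simps)
  then show ?thesis by (simp add: mills_def[abs_def])
qed

lemma mult_mills_le_1: "x * mills x \<le> 1"
  using normal_tail_upper[of x] std_normal_density_pos[of x] by (simp add: mills_def field_simps)

text \<open>The derivative is \<open>(1 + u\<^sup>2) * mills u - u\<close>, which
  \<open>normal_tail_lower\<close> makes nonnegative. The bounds on \<open>w * stein z w\<close>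
  rest on this and on \<open>mult_mills_le_1\<close>.\<close>

lemma mult_mills_mono:
  assumes "x \<le> y"
  shows "x * mills x \<le> y * mills y"
proof (rule DERIV_nonneg_imp_nondecreasing[OF assms])
  fix u
  have "((\<lambda>u. u * mills u) has_real_derivative (1 + u\<^sup>2) * mills u - u) (at u)"
    by (auto intro!: derivative_eq_intros mills_has_real_derivative simp: algebra_simps power2_eq_square)
  moreover have "0 \<le> (1 + u\<^sup>2) * mills u - u"
    using normal_tail_lower[of u] std_normal_density_pos[of u] by (simp add: mills_def field_simps)
  ultimately show "\<exists>d. ((\<lambda>u. u * mills u) has_real_derivative d) (at u) \<and> 0 \<le> d" by blast
qed

text \<open>The bounded solution of \<open>f'(w) - w f(w) = of_bool (w \<le> z) - Phi z\<close>.\<close>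

definition stein :: "real \<Rightarrow> real \<Rightarrow> real" where
  "stein z w = (if w \<le> z then (1 - Phi z) * mills (- w) else Phi z * mills w)"

lemma stein_le: "w \<le> z \<Longrightarrow> stein z w = (1 - Phi z) * mills (- w)"
  by (simp add: stein_def)

text \<open>The two branches agree at \<open>w = z\<close>, by the symmetry of \<open>Phi\<close>
  and of the density, so increments on either side of \<open>z\<close> can be glued there.\<close>

lemma stein_ge: "z \<le> w \<Longrightarrow> stein z w = Phi z * mills w"
  by (cases "w = z") (auto simp: stein_def mills_def Phi_minus std_normal_density_def)

text \<open>On each side of \<open>z\<close> this is \<open>mult_mills_mono\<close>; points on
  opposite sides are compared through \<open>z\<close>.\<close>

lemma mult_stein_mono:
  assumes "u \<le> w"
  shows "u * stein z u \<le> w * stein z w"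
proof -
  have le: "u * stein z u \<le> w * stein z w" if "u \<le> w" "w \<le> z" for u w
  proof -
    have "u * mills (- u) \<le> w * mills (- w)"
      using mult_mills_mono[of "- w" "- u"] that by simp
    then have "(1 - Phi z) * (u * mills (- u)) \<le> (1 - Phi z) * (w * mills (- w))"
      using Phi_le_1[of z] by (intro mult_left_mono) auto
    then show ?thesis using that by (simp add: stein_le mult.left_commute)
  qed
  have ge: "u * stein z u \<le> w * stein z w" if "u \<le> w" "z \<le> u" for u w
    using mult_left_mono[OF mult_mills_mono[OF that(1)] Phi_nonneg[of z]] that
    by (simp add: stein_ge mult.left_commute)
  consider "w \<le> z" | "z \<le> u" | "u \<le> z" "z \<le> w" by linarith
  then show ?thesis using assms le[of u w] ge[of u w] le[of u z] ge[of z w] by cases auto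
qed

text \<open>Monotonicity allows moving \<open>w\<close> up to \<open>max w z\<close>, where the
  right branch applies. With \<open>mult_stein_ge\<close>, the increasing function
  \<open>w * stein z w\<close> takes values in an interval of length 1.\<close>

lemma mult_stein_le: "w * stein z w \<le> Phi z"
proof -
  have "w * stein z w \<le> max w z * stein z (max w z)" by (rule mult_stein_mono) simp
  also have "\<dots> = Phi z * (max w z * mills (max w z))" by (simp add: stein_ge)
  also have "\<dots> \<le> Phi z * 1" by (intro mult_left_mono mult_mills_le_1 Phi_nonneg)
  finally show ?thesis by simp
qed

lemma mult_stein_ge: "Phi z - 1 \<le> w * stein z w"
proof -
  have "(1 - Phi z) * (- min w z * mills (- min w z)) \<le> (1 - Phi z) * 1"
    using Phi_le_1[of z] by (intro mult_left_mono mult_mills_le_1) auto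
  then have "Phi z - 1 \<le> min w z * stein z (min w z)"
    by (simp add: stein_le mult.left_commute)
  also have "\<dots> \<le> w * stein z w" by (rule mult_stein_mono) simp
  finally show ?thesis .
qed

text \<open>Mean value theorem: left of \<open>z\<close> the derivative at \<open>x\<close> is
  \<open>x * stein z x + 1 - Phi z\<close>, and monotonicity traps \<open>x * stein z x\<close>
  between its values at \<open>a\<close> and \<open>b\<close>.\<close>

lemma stein_diff_le:
  assumes "a \<le> b" "b \<le> z"
  shows "(b - a) * (a * stein z a + 1 - Phi z) \<le> stein z b - stein z a"
    and "stein z b - stein z a \<le> (b - a) * (b * stein z b + 1 - Phi z)"
proof -
  have "(b - a) * (a * stein z a + 1 - Phi z) \<le> stein z b - stein z a \<and>
     stein z b - stein z a \<le> (b - a) * (b * stein z b + 1 - Phi z)"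
  proof (cases "a = b")
    case False
    then have "a < b" using assms by simp
    have "((\<lambda>w. (1 - Phi z) * mills (- w)) has_real_derivative
       (1 - Phi z) * (x * mills (- x) + 1)) (at x)" for x
      by (rule derivative_eq_intros DERIV_chain2[where f = mills and g = uminus]
          mills_has_real_derivative refl)+ simp
    then obtain x where x: "a < x" "x < b"
      "(1 - Phi z) * mills (- b) - (1 - Phi z) * mills (- a)
         = (b - a) * ((1 - Phi z) * (x * mills (- x) + 1))"
      using MVT2[OF \<open>a < b\<close>, where f = "\<lambda>w. (1 - Phi z) * mills (- w)"
         and f' = "\<lambda>x. (1 - Phi z) * (x * mills (- x) + 1)"] by blast
    then have "stein z b - stein z a = (b - a) * (x * stein z x + 1 - Phi z)"
      using assms by (simp add: stein_le algebra_simps)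
    moreover have "a * stein z a \<le> x * stein z x" "x * stein z x \<le> b * stein z b"
      using x by (auto intro: mult_stein_mono)
    ultimately show ?thesis using \<open>a < b\<close> by simp
  qed simp
  then show "(b - a) * (a * stein z a + 1 - Phi z) \<le> stein z b - stein z a"
    and "stein z b - stein z a \<le> (b - a) * (b * stein z b + 1 - Phi z)" by auto
qed

lemma stein_diff_ge:
  assumes "a \<le> b" "z \<le> a"
  shows "(b - a) * (a * stein z a - Phi z) \<le> stein z b - stein z a"
    and "stein z b - stein z a \<le> (b - a) * (b * stein z b - Phi z)"
proof -
  have "(b - a) * (a * stein z a - Phi z) \<le> stein z b - stein z a \<and>
     stein z b - stein z a \<le> (b - a) * (b * stein z b - Phi z)"
  proof (cases "a = b")
    case False
    then have "a < b" using assms by simp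
    have "((\<lambda>w. Phi z * mills w) has_real_derivative Phi z * (x * mills x - 1)) (at x)" for x
      by (rule derivative_eq_intros mills_has_real_derivative refl)+ simp
    then obtain x where x: "a < x" "x < b"
      "Phi z * mills b - Phi z * mills a = (b - a) * (Phi z * (x * mills x - 1))"
      using MVT2[OF \<open>a < b\<close>, where f = "\<lambda>w. Phi z * mills w"
         and f' = "\<lambda>x. Phi z * (x * mills x - 1)"] by blast
    then have "stein z b - stein z a = (b - a) * (x * stein z x - Phi z)"
      using assms by (simp add: stein_ge algebra_simps)
    moreover have "a * stein z a \<le> x * stein z x" "x * stein z x \<le> b * stein z b"
      using x by (auto intro: mult_stein_mono)
    ultimately show ?thesis using \<open>a < b\<close> by simp
  qed simp
  then show "(b - a) * (a * stein z a - Phi z) \<le> stein z b - stein z a"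
    and "stein z b - stein z a \<le> (b - a) * (b * stein z b - Phi z)" by auto
qed

text \<open>If \<open>z\<close> lies inside \<open>[a, b]\<close>, the jump of \<open>f'\<close> is spread out: \<open>\<theta>\<close> is the proportion of the
  interval to the left of \<open>z\<close>.\<close>

lemma stein_diff:
  assumes "a < b"
  obtains \<theta> where "0 \<le> \<theta>" "\<theta> \<le> 1" "b \<le> z \<Longrightarrow> \<theta> = 1" "z \<le> a \<Longrightarrow> \<theta> = 0"
    "(b - a) * (a * stein z a + \<theta> - Phi z) \<le> stein z b - stein z a"
    "stein z b - stein z a \<le> (b - a) * (b * stein z b + \<theta> - Phi z)"
proof -
  consider "b \<le> z" | "z \<le> a" | "a < z" "z < b" by linarith
  then show thesis
  proof cases
    case 1
    then show thesis using stein_diff_le[of a b z] assms by (intro that[of 1]) auto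
  next
    case 2
    then show thesis using stein_diff_ge[of a b z] assms by (intro that[of 0]) auto
  next
    case 3
    define \<theta> where "\<theta> = (z - a) / (b - a)"
    have \<theta>: "(b - a) * \<theta> = z - a" using assms by (simp add: \<theta>_def)
    have m: "a * stein z a \<le> z * stein z z" "z * stein z z \<le> b * stein z b"
      using 3 by (auto intro: mult_stein_mono)
    \<comment> \<open>The increments over \<open>[a, z]\<close> and \<open>[z, b]\<close> will be
      added; \<open>z * stein z z\<close> is replaced by the value at \<open>a\<close> for the lower
      bound and at \<open>b\<close> for the upper one.\<close>
    have lo: "(b - z) * (a * stein z a) \<le> (b - z) * (z * stein z z)"
      and hi: "(z - a) * (z * stein z z) \<le> (z - a) * (b * stein z b)"
      using m 3 by (auto intro: mult_left_mono)
    have "(b - a) * (a * stein z a + \<theta> - Phi z) \<le> stein z b - stein z a"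
      using stein_diff_le(1)[of a z z] stein_diff_ge(1)[of z b z] 3 lo \<theta>
      by (simp add: algebra_simps)
    moreover have "stein z b - stein z a \<le> (b - a) * (b * stein z b + \<theta> - Phi z)"
      using stein_diff_le(2)[of a z z] stein_diff_ge(2)[of z b z] 3 hi \<theta>
      by (simp add: algebra_simps)
    ultimately show thesis using 3 assms by (intro that[of \<theta>]) (auto simp: \<theta>_def)
  qed
qed

subsection \<open>The symmetric binomial distribution\<close>

text \<open>Pascal's rule: \<open>Suc N\<close> fair coins are \<open>N\<close> fair coins plus one
  more.\<close>

lemma sum_binomial_Suc:
  fixes g :: "nat \<Rightarrow> real"
  shows "(\<Sum>k\<le>Suc N. real (Suc N choose k) * g k) = (\<Sum>j\<le>N. real (N choose j) * (g j + g (Suc j)))"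
proof -
  have "(\<Sum>k\<le>Suc N. real (Suc N choose k) * g k) =
      g 0 + (\<Sum>k\<le>N. real (N choose Suc k) * g (Suc k)) + (\<Sum>k\<le>N. real (N choose k) * g (Suc k))"
    by (subst sum.atMost_Suc_shift) (simp add: algebra_simps sum.distrib)
  also have "g 0 + (\<Sum>k\<le>N. real (N choose Suc k) * g (Suc k)) = (\<Sum>k\<le>Suc N. real (N choose k) * g k)"
    by (subst sum.atMost_Suc_shift) simp
  also have "\<dots> = (\<Sum>k\<le>N. real (N choose k) * g k)"
    by simp
  finally show ?thesis by (simp add: algebra_simps sum.distrib)
qed

text \<open>Stein's identity for the symmetric binomial law, without normalisation. Write
  \<open>2 * k - Suc N\<close> as \<open>k - (Suc N - k)\<close> and absorb each factor into the
  binomial coefficient.\<close>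

lemma sum_binomial_Suc_centred:
  fixes g :: "nat \<Rightarrow> real"
  shows "(\<Sum>k\<le>Suc N. real (Suc N choose k) * ((2 * real k - real (Suc N)) * g k))
    = real (Suc N) * (\<Sum>j\<le>N. real (N choose j) * (g (Suc j) - g j))"
proof -
  have "(\<Sum>k\<le>Suc N. real (Suc N choose k) * ((2 * real k - real (Suc N)) * g k))
     = (\<Sum>k\<le>Suc N. real (k * (Suc N choose k)) * g k) - (\<Sum>k\<le>Suc N. real ((Suc N - k) * (Suc N choose k)) * g k)"
    unfolding sum_subtractf[symmetric]
    by (intro sum.cong refl)
      (auto simp: left_diff_distrib right_diff_distrib of_nat_diff mult_ac simp del: binomial_Suc_Suc of_nat_Suc)
  also have "(\<Sum>k\<le>Suc N. real (k * (Suc N choose k)) * g k)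
      = (\<Sum>j\<le>N. real (Suc N * (N choose j)) * g (Suc j))"
    by (subst sum.atMost_Suc_shift)
      (simp add: Suc_times_binomial del: binomial_Suc_Suc of_nat_mult mult_Suc)
  also have "(\<Sum>k\<le>Suc N. real ((Suc N - k) * (Suc N choose k)) * g k)
      = (\<Sum>j\<le>N. real (Suc N * (N choose j)) * g j)"
    by (simp add: binomial_absorb_comp binomial_eq_0 del: binomial_Suc_Suc of_nat_mult)
  also have "(\<Sum>j\<le>N. real (Suc N * (N choose j)) * g (Suc j)) - (\<Sum>j\<le>N. real (Suc N * (N choose j)) * g j)
    = real (Suc N) * (\<Sum>j\<le>N. real (N choose j) * (g (Suc j) - g j))"
    unfolding sum_distrib_left sum_subtractf[symmetric]
    by (intro sum.cong refl) (simp only: of_nat_mult right_diff_distrib mult.assoc)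
  finally show ?thesis .
qed

text \<open>Consecutive values of the left side have quotient
  \<open>(2 * m + 1) / (2 * m + 2)\<close>, so the induction step comes down to
  \<open>(2 * m + 1) * (2 * m + 3) \<le> (2 * m + 2)\<^sup>2\<close>.\<close>

lemma central_binomial_upper_bound: "real (2 * m choose m) / 4 ^ m \<le> 1 / sqrt (2 * m + 1)"
proof (induction m)
  case (Suc m)
  have "Suc m * (2 * Suc m choose Suc m) = Suc m * (2 * (Suc (2 * m) choose m))"
    using Suc_times_binomial_eq[of "Suc (2 * m)" m] by (simp add: algebra_simps del: binomial_Suc_Suc)
  also have "\<dots> = 2 * (Suc (2 * m) * (2 * m choose m))"
  proof -
    have "Suc (2 * m) - m = Suc m" by simp
    then have "Suc m * (Suc (2 * m) choose m) = Suc (2 * m) * (2 * m choose m)"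
      using binomial_absorb_comp[of "Suc (2 * m)" m] by (metis diff_Suc_1)
    then show ?thesis by (metis mult.left_commute)
  qed
  finally have "real (Suc m * (2 * Suc m choose Suc m)) = real (2 * (Suc (2 * m) * (2 * m choose m)))"
    by (rule arg_cong)
  then have step: "real (2 * Suc m choose Suc m) = 2 * (2 * real m + 1) * real (2 * m choose m) / (real m + 1)"
    by (simp add: field_simps del: binomial_Suc_Suc)
  have "real (2 * Suc m choose Suc m) / 4 ^ Suc m
      = (2 * m + 1) / (2 * m + 2) * (real (2 * m choose m) / 4 ^ m)"
  proof -
    have "2 * (2 * u + 1) * c / (u + 1) / (4 * q) = (2 * u + 1) / (2 * u + 2) * (c / q)"
      if "u \<ge> 0" "q > 0" for u c q :: real
    proof -
      have "2 * u + 2 = 2 * (u + 1)" "u + 1 \<noteq> 0" using that by auto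
      then show ?thesis using that by (simp add: divide_simps) (simp add: algebra_simps)
    qed
    from this[of "real m" "4 ^ m"] show ?thesis unfolding step by (simp add: add.commute)
  qed
  also have "\<dots> \<le> (2 * m + 1) / (2 * m + 2) * (1 / sqrt (2 * m + 1))"
    by (intro mult_left_mono Suc.IH) auto
  also have "\<dots> = sqrt (2 * m + 1) / (2 * m + 2)"
  proof -
    have "u / v * (1 / r) = u / r / v" for u v r :: real by simp
    moreover have "real (2 * m + 1) / sqrt (2 * m + 1) = sqrt (2 * m + 1)" by (rule real_div_sqrt) simp
    ultimately show ?thesis by (simp only:)
  qed
  also have "\<dots> \<le> 1 / sqrt (2 * m + 3)"
  proof -
    have "sqrt (2 * m + 1) * sqrt (2 * m + 3) \<le> sqrt ((2 * m + 2)\<^sup>2)"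
      unfolding real_sqrt_mult[symmetric] by (intro real_sqrt_le_mono) (simp add: power2_eq_square algebra_simps)
    then show ?thesis by (simp add: field_simps del: real_sqrt_pow2)
  qed
  finally show ?case by (simp add: algebra_simps)
qed simp

text \<open>Pascal's rule and Stein's identity give two forms of one expectation: an average of
  neighbouring values of \<open>G\<close>, and an average of difference quotients \<open>D\<close>.
  As \<open>D j\<close> lies between \<open>G j\<close> and \<open>G (Suc j)\<close> up to the shift
  \<open>\<theta> j - Phi z\<close>, the mean of \<open>\<theta>\<close> must be close to
  \<open>Phi z\<close>.\<close>

lemma berry_esseen_symmetric_binomial:
  fixes z :: real
  assumes n: "n = 2 * m + 1"
  shows "\<bar>(\<Sum>k\<le>n. real (n choose k) / 2 ^ n * of_bool ((2 * real k - real n) / sqrt n \<le> z)) - Phi z\<bar>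
    \<le> 3 / (2 * sqrt n)"
proof -
  define N where "N = 2 * m"
  have nN: "n = Suc N" and n0: "0 < n" using n by (auto simp: N_def)
  define x where "x k = (2 * real k - real n) / sqrt n" for k
  \<comment> \<open>The law of \<open>n - 1 = 2 * m\<close> fair coins, whose largest atom is the
    central one.\<close>
  define w where "w j = real (N choose j) / 2 ^ N" for j
  define G where "G k = x k * stein z (x k)" for k
  define d where "d = 2 / sqrt n"
  have d0: "0 < d" and xd: "x (Suc k) - x k = d" for k
    using n0 by (auto simp: d_def x_def diff_divide_distrib[symmetric])
  have w0: "0 \<le> w j" for j by (simp add: w_def)
  have w_max: "w j \<le> 1 / sqrt n" for j
  proof -
    have "w j \<le> real (2 * m choose m) / 4 ^ m"
      using binomial_maximum'[of m j] by (simp add: w_def N_def power_mult divide_right_mono)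
    also have "\<dots> \<le> 1 / sqrt n" using central_binomial_upper_bound[of m] n by simp
    finally show ?thesis .
  qed
  have w_sum: "(\<Sum>j\<le>N. w j) = 1"
    by (simp add: w_def flip: sum_divide_distrib of_nat_sum, simp add: choose_row_sum)
  have expect: "(\<Sum>k\<le>n. real (n choose k) / 2 ^ n * g k) = (\<Sum>j\<le>N. w j * ((g j + g (Suc j)) / 2))"
    for g :: "nat \<Rightarrow> real"
    using arg_cong[OF sum_binomial_Suc[of N g], of "\<lambda>u. u / 2 ^ n"]
    by (simp add: nN w_def sum_divide_distrib mult.commute[of 2] del: binomial_Suc_Suc sum.atMost_Suc)
  have "x k < x (Suc k)" for k using xd[of k] d0 by simp
  from stein_diff[OF this, of _ z]
  have "\<exists>\<theta>. 0 \<le> \<theta> \<and> \<theta> \<le> 1 \<and> (x (Suc k) \<le> z \<longrightarrow> \<theta> = 1) \<and> (z \<le> x k \<longrightarrow> \<theta> = 0) \<and>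
    d * (G k + \<theta> - Phi z) \<le> stein z (x (Suc k)) - stein z (x k) \<and>
    stein z (x (Suc k)) - stein z (x k) \<le> d * (G (Suc k) + \<theta> - Phi z)" for k
    unfolding xd G_def by metis
  then obtain \<theta> where \<theta>: "\<And>k. 0 \<le> \<theta> k" "\<And>k. \<theta> k \<le> 1" "\<And>k. x (Suc k) \<le> z \<Longrightarrow> \<theta> k = 1"
    "\<And>k. z \<le> x k \<Longrightarrow> \<theta> k = 0"
    "\<And>k. d * (G k + \<theta> k - Phi z) \<le> stein z (x (Suc k)) - stein z (x k)"
    "\<And>k. stein z (x (Suc k)) - stein z (x k) \<le> d * (G (Suc k) + \<theta> k - Phi z)"
    by metis
  define D where "D k = (stein z (x (Suc k)) - stein z (x k)) / d" for k
  have D: "G k + \<theta> k - Phi z \<le> D k" "D k \<le> G (Suc k) + \<theta> k - Phi z" for k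
    using \<theta>(5,6)[of k] d0 by (auto simp: D_def field_simps)
  \<comment> \<open>Both sides are \<open>E [W f(W)]\<close> for the standardised binomial variable \<open>W\<close>.\<close>
  have stein_id: "(\<Sum>j\<le>N. w j * ((G j + G (Suc j)) / 2)) = (\<Sum>j\<le>N. w j * D j)"
  proof -
    have "(\<Sum>j\<le>N. w j * ((G j + G (Suc j)) / 2)) = (\<Sum>k\<le>n. real (n choose k) / 2 ^ n * G k)"
      by (rule expect[symmetric])
    also have "\<dots> = (\<Sum>k\<le>n. real (n choose k) * ((2 * real k - real n) * stein z (x k))) / (2 ^ n * sqrt n)"
      by (simp add: sum_divide_distrib G_def x_def mult_ac)
    also have "\<dots> = real n * (\<Sum>j\<le>N. real (N choose j) * (stein z (x (Suc j)) - stein z (x j))) / (2 ^ n * sqrt n)"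
      unfolding nN by (subst sum_binomial_Suc_centred) simp
    also have "\<dots> = real n / sqrt n * (\<Sum>j\<le>N. real (N choose j) * (stein z (x (Suc j)) - stein z (x j))) / 2 ^ n"
      by simp
    also have "real n / sqrt n = sqrt n" by (simp add: real_div_sqrt)
    also have "sqrt n * (\<Sum>j\<le>N. real (N choose j) * (stein z (x (Suc j)) - stein z (x j))) / 2 ^ n
       = (\<Sum>j\<le>N. w j * D j)"
      by (simp add: sum_distrib_left sum_divide_distrib w_def D_def d_def nN mult_ac)
    finally show ?thesis .
  qed
  have G_mono: "0 \<le> G (Suc k) - G k" for k
    using xd[of k] d0 by (auto simp: G_def intro!: mult_stein_mono)
  \<comment> \<open>Each atom is at most \<open>1 / sqrt n\<close>, and the increments of
    \<open>G\<close> telescope to at most 1.\<close>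
  have "(\<Sum>j\<le>N. w j * (G (Suc j) - G j)) \<le> (\<Sum>j\<le>N. 1 / sqrt n * (G (Suc j) - G j))"
    by (intro sum_mono mult_right_mono w_max G_mono)
  also have "\<dots> = 1 / sqrt n * (G n - G 0)"
    unfolding sum_distrib_left[symmetric]
    using sum_lessThan_telescope[of G n] by (simp add: nN lessThan_Suc_atMost)
  also have "\<dots> \<le> 1 / sqrt n * 1"
    using mult_stein_le[of "x n" z] mult_stein_ge[of z "x 0"]
    by (intro mult_left_mono) (auto simp: G_def)
  finally have TV: "(\<Sum>j\<le>N. w j * (G (Suc j) - G j)) \<le> 1 / sqrt n" by simp
  have centre: "(\<Sum>j\<le>N. w j * (\<theta> j - Phi z)) = (\<Sum>j\<le>N. w j * \<theta> j) - Phi z"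
    by (simp add: right_diff_distrib sum_subtractf w_sum flip: sum_distrib_right)
  have up: "(\<Sum>j\<le>N. w j * \<theta> j) - Phi z \<le> 1 / (2 * sqrt n)"
  proof -
    have "(\<Sum>j\<le>N. w j * \<theta> j) - Phi z \<le> (\<Sum>j\<le>N. w j * (D j - G j))"
      unfolding centre[symmetric] using D(1) by (intro sum_mono mult_left_mono w0) (simp add: algebra_simps)
    \<comment> \<open>By \<open>stein_id\<close> the average of \<open>D\<close> is that of the
      midpoints of \<open>G j\<close> and \<open>G (Suc j)\<close>, so half a step of
      \<open>G\<close> remains.\<close>
    also have "\<dots> = (\<Sum>j\<le>N. w j * (G (Suc j) - G j)) / 2"
      using stein_id by (simp add: algebra_simps sum_subtractf sum.distrib add_divide_distrib flip: sum_divide_distrib)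
    finally show ?thesis using TV by simp
  qed
  have lo: "- (1 / (2 * sqrt n)) \<le> (\<Sum>j\<le>N. w j * \<theta> j) - Phi z"
  proof -
    have "(\<Sum>j\<le>N. w j * \<theta> j) - Phi z \<ge> (\<Sum>j\<le>N. w j * (D j - G (Suc j)))"
      unfolding centre[symmetric] using D(2) by (intro sum_mono mult_left_mono w0) (simp add: algebra_simps)
    also have "(\<Sum>j\<le>N. w j * (D j - G (Suc j))) = - (\<Sum>j\<le>N. w j * (G (Suc j) - G j)) / 2"
      using stein_id by (simp add: algebra_simps sum_subtractf sum.distrib add_divide_distrib flip: sum_divide_distrib)
    finally show ?thesis using TV by simp
  qed
  define p where "p k = (of_bool (x k \<le> z) :: real)" for k
  \<comment> \<open>Passing from \<open>\<theta>\<close> to the indicator costs at most one atom: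
    the two agree except where \<open>p\<close> drops from 1 to 0.\<close>
  have "\<bar>(\<Sum>j\<le>N. w j * ((p j + p (Suc j)) / 2)) - (\<Sum>j\<le>N. w j * \<theta> j)\<bar>
     \<le> (\<Sum>j\<le>N. \<bar>w j * ((p j + p (Suc j)) / 2) - w j * \<theta> j\<bar>)"
    unfolding sum_subtractf[symmetric] by (rule sum_abs)
  also have "\<dots> \<le> (\<Sum>j\<le>N. 1 / sqrt n * (p j - p (Suc j)))"
  proof (rule sum_mono)
    fix j
    have "\<bar>(p j + p (Suc j)) / 2 - \<theta> j\<bar> \<le> p j - p (Suc j)"
      using \<theta>(1-4)[of j] xd[of j] d0 by (auto simp: p_def)
    then have "w j * \<bar>(p j + p (Suc j)) / 2 - \<theta> j\<bar> \<le> 1 / sqrt n * (p j - p (Suc j))"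
      using w_max[of j] w0[of j] by (intro mult_mono) auto
    then show "\<bar>w j * ((p j + p (Suc j)) / 2) - w j * \<theta> j\<bar> \<le> 1 / sqrt n * (p j - p (Suc j))"
      unfolding right_diff_distrib[symmetric] abs_mult using w0[of j] by simp
  qed
  also have "\<dots> = 1 / sqrt n * (p 0 - p n)"
    unfolding sum_distrib_left[symmetric]
    using sum_lessThan_telescope'[of p n] by (simp add: nN lessThan_Suc_atMost)
  also have "\<dots> \<le> 1 / sqrt n * 1"
    by (intro mult_left_mono) (auto simp: p_def)
  finally have "\<bar>(\<Sum>j\<le>N. w j * ((p j + p (Suc j)) / 2)) - (\<Sum>j\<le>N. w j * \<theta> j)\<bar> \<le> 1 / sqrt n" by simp
  moreover have "(\<Sum>k\<le>n. real (n choose k) / 2 ^ n * p k) = (\<Sum>j\<le>N. w j * ((p j + p (Suc j)) / 2))"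
    by (rule expect)
  moreover have "3 / (2 * sqrt n) = 1 / sqrt n + 1 / (2 * sqrt n)"
    using n0 by (simp add: field_simps)
  ultimately show ?thesis using up lo unfolding p_def x_def by linarith
qed

subsection \<open>Walsh characters\<close>

text \<open>For finite \<open>A\<close> this is \<open>(-1) ^ card (A \<inter> T)\<close>, the Walsh
  character indexed by \<open>A\<close> evaluated at \<open>T\<close>.\<close>

definition walsh :: "'a set \<Rightarrow> 'a set \<Rightarrow> real" where
  "walsh A T = (\<Prod>i\<in>A. if i \<in> T then - 1 else 1)"

lemma abs_walsh [simp]: "\<bar>walsh A T\<bar> = 1"
  unfolding walsh_def abs_prod by (intro prod.neutral) auto

lemma walsh_empty [simp]: "walsh {} T = 1"
  by (simp add: walsh_def)

lemma walsh_cong: "(\<And>i. i \<in> A \<Longrightarrow> i \<in> T \<longleftrightarrow> i \<in> T') \<Longrightarrow> walsh A T = walsh A T'"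
  unfolding walsh_def by (intro prod.cong) auto

lemma walsh_insert:
  assumes "finite A" "i \<in> A"
  shows "walsh A (insert i T) = - walsh A (T - {i})"
proof -
  have "walsh A S = (if i \<in> S then - 1 else 1) * walsh (A - {i}) S" for S
    unfolding walsh_def using assms by (simp add: prod.remove)
  moreover have "walsh (A - {i}) (insert i T) = walsh (A - {i}) (T - {i})"
    by (rule walsh_cong) auto
  ultimately show ?thesis by simp
qed

text \<open>The sum over \<open>A\<close> factors into a product over the points of
  \<open>N\<close>; a point in exactly one of \<open>S\<close> and \<open>T\<close> contributes
  \<open>-1 + 1 = 0\<close>.\<close>

lemma walsh_orthogonal:
  assumes "finite N" "S \<subseteq> N" "T \<subseteq> N"
  shows "(\<Sum>A\<in>Pow N. walsh A S * walsh A T) = (if S = T then 2 ^ card N else 0)"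
proof -
  let ?s = "\<lambda>i. (if i \<in> S then - 1 else 1) * (if i \<in> T then - 1 else (1::real))"
  have "(\<Sum>A\<in>Pow N. walsh A S * walsh A T) = (\<Sum>A\<in>Pow N. (\<Prod>i\<in>A. ?s i) * (\<Prod>i\<in>N - A. 1))"
    by (simp add: walsh_def prod.distrib)
  also have "\<dots> = (\<Prod>i\<in>N. ?s i + 1)"
    by (rule prod_add[symmetric]) (fact assms)
  also have "\<dots> = (if S = T then 2 ^ card N else 0)"
  proof (cases "S = T")
    case True
    then have "(\<Prod>i\<in>N. ?s i + 1) = (\<Prod>i\<in>N. 2)" by (intro prod.cong) auto
    then show ?thesis using True by simp
  next
    case False
    then obtain i where "i \<in> N" "i \<in> S \<longleftrightarrow> i \<notin> T" using assms by blast
    then have "(\<Prod>i\<in>N. ?s i + 1) = 0" using assms(1) by (intro prod_zero bexI[of _ i]) auto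
    then show ?thesis using False by simp
  qed
  finally show ?thesis .
qed

text \<open>The points covered an odd number of times form the symmetric difference of the
  \<open>W r\<close>, and characters turn symmetric differences into products.\<close>

lemma walsh_parity:
  assumes "finite R"
  shows "walsh A {j. odd (card {r \<in> R. j \<in> W r})} = (\<Prod>r\<in>R. walsh A (W r))"
proof -
  have "(if odd (card {r \<in> R. P r}) then - 1 else 1) = (\<Prod>r\<in>R. if P r then - 1 else (1::real))" for P
  proof -
    have "(\<Prod>r\<in>R. if P r then - 1 else (1::real)) = (- 1) ^ card {r \<in> R. P r}"
      using assms by (simp add: prod.If_cases Int_def)
    then show ?thesis by auto
  qed
  then show ?thesis unfolding walsh_def by (simp add: prod.swap[of _ R])
qed

text \<open>Fourier inversion: the empty character produces the uniform law, and the others move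
  each point mass by at most \<open>K / 2 ^ card N\<close>. There are \<open>2 ^ card N\<close>
  points to sum over.\<close>

lemma pmf_dist_uniform_le:
  fixes p :: "'a set pmf"
  assumes "finite N" "set_pmf p \<subseteq> Pow N"
  shows "\<bar>measure_pmf.prob p E - card (E \<inter> Pow N) / 2 ^ card N\<bar>
    \<le> (\<Sum>A\<in>Pow N - {{}}. \<bar>measure_pmf.expectation p (walsh A)\<bar>)"
proof -
  define c where "c A = measure_pmf.expectation p (walsh A)" for A
  have finP: "finite (Pow N)" using assms by simp
  have c_sum: "c A = (\<Sum>T\<in>Pow N. pmf p T * walsh A T)" for A
    unfolding c_def using assms by (subst integral_measure_pmf[OF finP]) auto
  have c_empty: "c {} = 1" by (simp add: c_def walsh_def[abs_def])
  have inversion: "pmf p S * 2 ^ card N = (\<Sum>A\<in>Pow N. c A * walsh A S)" if "S \<in> Pow N" for S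
  proof -
    have "(\<Sum>A\<in>Pow N. c A * walsh A S) = (\<Sum>T\<in>Pow N. pmf p T * (\<Sum>A\<in>Pow N. walsh A T * walsh A S))"
      unfolding c_sum sum_distrib_left sum_distrib_right mult.assoc by (rule sum.swap)
    also have "\<dots> = (\<Sum>T\<in>Pow N. if T = S then pmf p T * 2 ^ card N else 0)"
      using that assms(1) by (intro sum.cong refl) (auto simp: walsh_orthogonal)
    also have "\<dots> = pmf p S * 2 ^ card N" using that finP by (simp add: sum.delta')
    finally show ?thesis ..
  qed
  define K where "K = (\<Sum>A\<in>Pow N - {{}}. \<bar>c A\<bar>)"
  have pointwise: "\<bar>pmf p S - 1 / 2 ^ card N\<bar> \<le> K / 2 ^ card N" if "S \<in> Pow N" for S
  proof -
    have "pmf p S * 2 ^ card N - 1 = (\<Sum>A\<in>Pow N - {{}}. c A * walsh A S)"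
      unfolding inversion[OF that] using finP by (subst sum.remove[of _ "{}"]) (auto simp: c_empty)
    also have "\<bar>\<dots>\<bar> \<le> (\<Sum>A\<in>Pow N - {{}}. \<bar>c A * walsh A S\<bar>)" by (rule sum_abs)
    finally have "\<bar>pmf p S * 2 ^ card N - 1\<bar> \<le> K" by (simp add: abs_mult K_def)
    then show ?thesis by (simp add: abs_le_iff field_simps)
  qed
  have "measure_pmf.prob p E = measure_pmf.prob p (E \<inter> Pow N)"
    using assms by (intro measure_pmf.finite_measure_eq_AE) (auto simp: AE_measure_pmf_iff)
  also have "\<dots> = (\<Sum>S\<in>E \<inter> Pow N. pmf p S)"
    using finP by (intro measure_measure_pmf_finite) auto
  finally have "\<bar>measure_pmf.prob p E - card (E \<inter> Pow N) / 2 ^ card N\<bar>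
      = \<bar>\<Sum>S\<in>E \<inter> Pow N. pmf p S - 1 / 2 ^ card N\<bar>"
    by (simp add: sum_subtractf)
  also have "\<dots> \<le> (\<Sum>S\<in>E \<inter> Pow N. \<bar>pmf p S - 1 / 2 ^ card N\<bar>)" by (rule sum_abs)
  also have "\<dots> \<le> (\<Sum>S\<in>E \<inter> Pow N. K / 2 ^ card N)" by (intro sum_mono pointwise) auto
  also have "\<dots> \<le> (\<Sum>S\<in>Pow N. K / 2 ^ card N)"
    using finP by (intro sum_mono2) (auto simp: K_def sum_nonneg)
  also have "\<dots> = K" using assms(1) by (simp add: card_Pow)
  finally show ?thesis by (simp add: K_def c_def)
qed

section \<open>Fourier coefficients of a uniform random subset of given size\<close>

definition layer :: "'a set \<Rightarrow> nat \<Rightarrow> 'a set set" where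
  "layer N s = {T. T \<subseteq> N \<and> card T = s}"

lemma finite_layer: "finite N \<Longrightarrow> finite (layer N s)"
  by (simp add: layer_def)

lemma card_layer: "finite N \<Longrightarrow> card (layer N s) = card N choose s"
  by (simp add: layer_def n_subsets)

text \<open>The mean of the character of \<open>A\<close> over a uniform \<open>s\<close>-subset, a
  normalised value of a Krawtchouk polynomial.\<close>

definition layer_coeff :: "'a set \<Rightarrow> nat \<Rightarrow> 'a set \<Rightarrow> real" where
  "layer_coeff N s A = (\<Sum>T\<in>layer N s. walsh A T) / (card N choose s)"

text \<open>After expanding the square, orthogonality keeps only the diagonal, one term for each of
  the \<open>card N choose s\<close> sets.\<close>

lemma parseval_layer:
  assumes "finite N" "s \<le> card N"
  shows "(\<Sum>A\<in>Pow N. (layer_coeff N s A)\<^sup>2) = 2 ^ card N / (card N choose s)"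
proof -
  let ?C = "real (card N choose s)"
  have C: "?C \<noteq> 0" using assms by simp
  have "(\<Sum>A\<in>Pow N. (\<Sum>T\<in>layer N s. walsh A T)\<^sup>2)
      = (\<Sum>A\<in>Pow N. \<Sum>S\<in>layer N s. \<Sum>T\<in>layer N s. walsh A S * walsh A T)"
    by (simp add: power2_eq_square sum_product)
  also have "\<dots> = (\<Sum>S\<in>layer N s. \<Sum>A\<in>Pow N. \<Sum>T\<in>layer N s. walsh A S * walsh A T)"
    by (rule sum.swap)
  also have "\<dots> = (\<Sum>S\<in>layer N s. \<Sum>T\<in>layer N s. \<Sum>A\<in>Pow N. walsh A S * walsh A T)"
    by (intro sum.cong refl sum.swap)
  also have "\<dots> = (\<Sum>S\<in>layer N s. \<Sum>T\<in>layer N s. if S = T then 2 ^ card N else 0)"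
    using assms by (intro sum.cong refl walsh_orthogonal) (auto simp: layer_def)
  also have "\<dots> = ?C * 2 ^ card N"
    using assms finite_layer[OF assms(1)] by (simp add: card_layer)
  finally have sq: "(\<Sum>A\<in>Pow N. (\<Sum>T\<in>layer N s. walsh A T)\<^sup>2) = ?C * 2 ^ card N" .
  have "(\<Sum>A\<in>Pow N. (layer_coeff N s A)\<^sup>2) = (\<Sum>A\<in>Pow N. (\<Sum>T\<in>layer N s. walsh A T)\<^sup>2) / ?C\<^sup>2"
    unfolding layer_coeff_def power_divide by (rule sum_divide_distrib[symmetric])
  then show ?thesis unfolding sq using C by (simp add: power2_eq_square)
qed

text \<open>Deleting \<open>i\<close> is a bijection onto the \<open>(s - 1)\<close>-subsets of
  \<open>N - {i, j}\<close>.\<close>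

lemma card_layer_split:
  assumes "finite N" "i \<in> N" "j \<in> N" "i \<noteq> j" "1 \<le> s"
  shows "card {T \<in> layer N s. i \<in> T \<and> j \<notin> T} = (card N - 2) choose (s - 1)"
proof -
  have "bij_betw (insert i) (layer (N - {i, j}) (s - 1)) {T \<in> layer N s. i \<in> T \<and> j \<notin> T}"
  proof (rule bij_betwI[where g = "\<lambda>T. T - {i}"])
    show "insert i \<in> layer (N - {i, j}) (s - 1) \<rightarrow> {T \<in> layer N s. i \<in> T \<and> j \<notin> T}"
    proof
      fix T assume "T \<in> layer (N - {i, j}) (s - 1)"
      then have T: "T \<subseteq> N - {i, j}" "card T = s - 1" by (auto simp: layer_def)
      then have "finite T" using assms(1) finite_subset by blast
      moreover have "i \<notin> T" using T by auto
      ultimately show "insert i T \<in> {T \<in> layer N s. i \<in> T \<and> j \<notin> T}" using T assms by (auto simp: layer_def)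
    qed
    show "(\<lambda>T. T - {i}) \<in> {T \<in> layer N s. i \<in> T \<and> j \<notin> T} \<rightarrow> layer (N - {i, j}) (s - 1)"
      by (auto simp: layer_def)
  qed (auto simp: layer_def)
  then have "card {T \<in> layer N s. i \<in> T \<and> j \<notin> T} = card (layer (N - {i, j}) (s - 1))"
    by (simp add: bij_betw_same_card)
  also have "\<dots> = (card (N - {i, j})) choose (s - 1)" using assms by (simp add: card_layer)
  also have "card (N - {i, j}) = card N - 2" using assms by (simp add: card_Diff_subset)
  finally show ?thesis .
qed

text \<open>Take \<open>i\<close> in \<open>A\<close> and \<open>j\<close> in \<open>N - A\<close>.
  Sets containing exactly one of them cancel in pairs, and the subtracted fraction is the
  probability that a uniform \<open>s\<close>-subset is of this kind.\<close>

lemma abs_layer_coeff_le: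
  assumes "finite N" "A \<subseteq> N" "A \<noteq> {}" "A \<noteq> N" "1 \<le> s" "s \<le> card N"
  shows "\<bar>layer_coeff N s A\<bar> \<le> 1 - 2 * (real s * (real (card N) - real s)) / (real (card N) * (real (card N) - 1))"
proof -
  obtain i j where ij: "i \<in> A" "j \<in> N" "j \<notin> A" using assms by blast
  then have ij': "i \<in> N" "i \<noteq> j" using assms by auto
  let ?n = "card N"
  have "card {i, j} \<le> ?n" using ij ij' assms by (intro card_mono) auto
  then have n2: "2 \<le> ?n" using ij' by simp
  let ?P = "{T \<in> layer N s. i \<in> T \<and> j \<notin> T}" and ?Q = "{T \<in> layer N s. j \<in> T \<and> i \<notin> T}"
  let ?R = "layer N s - ?P - ?Q"
  have fin: "finite (layer N s)" using assms finite_layer by blast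
  have fA: "finite A" using assms finite_subset by blast
  \<comment> \<open>Exchanging \<open>i\<close> and \<open>j\<close> changes the sign, so only sets treating both alike survive.\<close>
  have swap: "(\<Sum>T\<in>?P. walsh A T) = (\<Sum>T\<in>?Q. - walsh A T)"
  proof (rule sum.reindex_bij_witness[where i = "\<lambda>T. insert i (T - {j})" and j = "\<lambda>T. insert j (T - {i})"])
    fix T assume T: "T \<in> ?P"
    then have "finite T" using assms(1) finite_subset by (auto simp: layer_def)
    then have "0 < card T" using T by (auto simp: card_gt_0_iff)
    with \<open>finite T\<close> show "insert j (T - {i}) \<in> ?Q" using T ij ij'
      by (auto simp: layer_def card_Suc_Diff1)
    have "walsh A (insert j (T - {i})) = walsh A (T - {i})"
      using ij by (intro walsh_cong) auto
    moreover have "walsh A T = - walsh A (T - {i})"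
      using walsh_insert[OF fA ij(1), of T] T by (simp add: insert_absorb)
    ultimately show "- walsh A (insert j (T - {i})) = walsh A T" by simp
  next
    fix T assume T: "T \<in> ?Q"
    then have "finite T" using assms(1) finite_subset by (auto simp: layer_def)
    then have "0 < card T" using T by (auto simp: card_gt_0_iff)
    with \<open>finite T\<close> show "insert i (T - {j}) \<in> ?P" using T ij ij'
      by (auto simp: layer_def card_Suc_Diff1)
  qed (use ij' in auto)
  have "(\<Sum>T\<in>layer N s. walsh A T) = (\<Sum>T\<in>?P. walsh A T) + ((\<Sum>T\<in>?Q. walsh A T) + (\<Sum>T\<in>?R. walsh A T))"
    using fin by (subst sum.subset_diff[of ?P]; (subst sum.subset_diff[of ?Q "layer N s - ?P"])?) auto
  also have "\<dots> = (\<Sum>T\<in>?R. walsh A T)" unfolding swap by (simp add: sum_negf)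
  finally have "\<bar>\<Sum>T\<in>layer N s. walsh A T\<bar> \<le> (\<Sum>T\<in>?R. \<bar>walsh A T\<bar>)"
    by (simp only: sum_abs)
  also have "\<dots> = real (card ?R)" by simp
  also have "card ?R = card (layer N s) - card ?P - card ?Q"
    using fin by (subst card_Diff_subset, auto)+
  also have "real \<dots> = real (card (layer N s)) - real (card ?P) - real (card ?Q)"
  proof -
    have "card ?P + card ?Q = card (?P \<union> ?Q)" using fin by (intro card_Un_disjoint[symmetric]) auto
    also have "\<dots> \<le> card (layer N s)" using fin by (intro card_mono) auto
    finally show ?thesis by (simp add: of_nat_diff)
  qed
  also have "\<dots> = real (?n choose s) - 2 * real ((?n - 2) choose (s - 1))"
    using card_layer_split[OF assms(1) ij'(1) ij(2) ij'(2) assms(5)]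
      card_layer_split[OF assms(1) ij(2) ij'(1) ij'(2)[symmetric] assms(5)] assms(1)
    by (simp add: card_layer)
  finally have bound: "\<bar>\<Sum>T\<in>layer N s. walsh A T\<bar> \<le> real (?n choose s) - 2 * real ((?n - 2) choose (s - 1))" .
  \<comment> \<open>Absorption twice: first both indices drop by one, then the upper index
    alone.\<close>
  have ratio: "real ((?n - 2) choose (s - 1)) * (real ?n * (real ?n - 1)) = real (?n choose s) * (real s * (real ?n - real s))"
  proof -
    obtain k where k: "?n = Suc (Suc k)" using n2 by (metis add_2_eq_Suc le_Suc_ex)
    obtain t where t: "s = Suc t" using assms(5) by (metis Suc_le_D One_nat_def)
    have "real (Suc t * (Suc (Suc k) choose Suc t)) = real (Suc (Suc k) * (Suc k choose t))"
      by (simp only: Suc_times_binomial)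
    moreover have "real ((Suc k - t) * (Suc k choose t)) = real (Suc k * (k choose t))"
      using binomial_absorb_comp[of "Suc k" t] by simp
    moreover have "real (Suc k - t) = real ?n - real s" using assms(6) k t by (simp add: of_nat_diff)
    ultimately have 1: "real s * real (?n choose s) = real ?n * real (Suc k choose t)"
      and 2: "(real ?n - real s) * real (Suc k choose t) = real (Suc k) * real (k choose t)"
      unfolding k t by (metis of_nat_mult)+
    have "real (?n choose s) * (real s * (real ?n - real s)) = real ?n * ((real ?n - real s) * real (Suc k choose t))"
      using arg_cong[OF 1, of "\<lambda>u. u * (real ?n - real s)"] by (simp add: mult_ac)
    also have "\<dots> = real ?n * (real (Suc k) * real (k choose t))" by (simp only: 2)
    finally show ?thesis using k t by (simp add: mult_ac)
  qed
  have C: "real (?n choose s) > 0" using assms by simp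
  have n0: "real ?n * (real ?n - 1) > 0" using n2 by simp
  have "\<bar>layer_coeff N s A\<bar> \<le> (real (?n choose s) - 2 * real ((?n - 2) choose (s - 1))) / real (?n choose s)"
    using bound C by (simp add: layer_coeff_def divide_right_mono)
  also have "\<dots> = 1 - 2 * (real ((?n - 2) choose (s - 1)) / real (?n choose s))"
    using C by (simp add: diff_divide_distrib)
  also have "real ((?n - 2) choose (s - 1)) / real (?n choose s) = real s * (real ?n - real s) / (real ?n * (real ?n - 1))"
    using ratio C n0 n2 by (intro frac_eq_eq[THEN iffD2]) (auto simp: mult_ac)
  finally show ?thesis by simp
qed

subsection \<open>The law of the set of lit bulbs\<close>

lemma expectation_bind_pmf_finite:
  fixes h :: "'b \<Rightarrow> real"
  assumes "finite (set_pmf p)" "\<And>x. x \<in> set_pmf p \<Longrightarrow> finite (set_pmf (f x))"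
  shows "measure_pmf.expectation (bind_pmf p f) h
    = measure_pmf.expectation p (\<lambda>x. measure_pmf.expectation (f x) h)"
  using assms by (subst pmf_expectation_bind[of "set_pmf p"], auto)
     (subst integral_measure_pmf[of "set_pmf p"], auto)

lemma expectation_prod_Pi_pmf_finite:
  fixes f :: "'a \<Rightarrow> 'b \<Rightarrow> real"
  assumes "finite I" "\<And>i. i \<in> I \<Longrightarrow> finite (set_pmf (p i))"
  shows "measure_pmf.expectation (Pi_pmf I d p) (\<lambda>y. \<Prod>i\<in>I. f i (y i))
    = (\<Prod>i\<in>I. measure_pmf.expectation (p i) (f i))"
proof -
  have comp: "map_pmf (\<lambda>y. y i) (Pi_pmf I d p) = p i" if "i \<in> I" for i
    using Pi_pmf_component[OF assms(1), of i d p] that by simp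
  have int: "integrable (measure_pmf (Pi_pmf I d p)) (\<lambda>y. f i (y i))" if "i \<in> I" for i
  proof -
    have "integrable (measure_pmf (map_pmf (\<lambda>y. y i) (Pi_pmf I d p))) (f i)"
      unfolding comp[OF that] using that assms by (intro integrable_measure_pmf_finite) auto
    then show ?thesis by (simp only: integrable_map_pmf_eq)
  qed
  have "measure_pmf.expectation (Pi_pmf I d p) (\<lambda>y. \<Prod>i\<in>I. f i (y i))
     = (\<Prod>i\<in>I. measure_pmf.expectation (Pi_pmf I d p) (\<lambda>y. f i (y i)))"
    using assms(1) int
    by (intro prob_space.indep_vars_lebesgue_integral[OF prob_space_measure_pmf]
        prob_space.indep_vars_compose2[OF prob_space_measure_pmf indep_vars_Pi_pmf]) auto
  also have "\<dots> = (\<Prod>i\<in>I. measure_pmf.expectation (p i) (f i))"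
    by (intro prod.cong refl) (simp flip: comp)
  finally show ?thesis .
qed

lemma abs_expectation_pmf_le_1:
  fixes f :: "'a \<Rightarrow> real"
  assumes "finite (set_pmf p)" "\<And>x. x \<in> set_pmf p \<Longrightarrow> \<bar>f x\<bar> \<le> 1"
  shows "\<bar>measure_pmf.expectation p f\<bar> \<le> 1"
proof -
  have "\<bar>measure_pmf.expectation p f\<bar> \<le> measure_pmf.expectation p (\<lambda>x. \<bar>f x\<bar>)"
    by (rule integral_abs_bound)
  also have "\<dots> \<le> 1"
    using assms by (intro measure_pmf.integral_le_const integrable_measure_pmf_finite)
      (auto simp: AE_measure_pmf_iff)
  finally show ?thesis .
qed

section \<open>The random set of lit bulbs and its Walsh coefficients\<close>

definition bulb_set :: "nat \<Rightarrow> (nat \<Rightarrow> nat set) \<Rightarrow> nat set" where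
  "bulb_set n W = {j \<in> {1..n}. odd (card {r \<in> {1..n}. j \<in> W r})}"

text \<open>The lit set is retained rather than its size, since characters of the set factor over
  the stages; \<open>V_pmf\<close> is its image under \<open>card\<close>.\<close>

definition V_set_pmf :: "nat \<Rightarrow> nat set pmf" where
  "V_set_pmf m = (let n = 2 * m + 1 in
     do { S \<leftarrow> switch_pmf n;
          b \<leftarrow> pmf_of_set ({1..n} - S m);
          b' \<leftarrow> pmf_of_set (S (m + 1));
          c \<leftarrow> bernoulli_pmf (1/2);
          c' \<leftarrow> bernoulli_pmf (1/2);
          return_pmf (bulb_set n (modify_switch m S b b' c c')) })"

lemma V_pmf_eq_map: "V_pmf m = map_pmf card (V_set_pmf m)"
  by (simp add: V_pmf_def V_set_pmf_def Let_def map_bind_pmf bulbs_on_def bulb_set_def)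

lemma set_V_set_pmf: "set_pmf (V_set_pmf m) \<subseteq> Pow {1..2 * m + 1}"
  by (auto simp: V_set_pmf_def Let_def bulb_set_def)

text \<open>The effect of a modified stage: the mean of the character when \<open>b\<close> is
  uniform on \<open>U\<close> and its membership in \<open>T\<close> is redrawn by a fair
  coin.\<close>

definition flip_coeff :: "'a set \<Rightarrow> 'a set \<Rightarrow> 'a set \<Rightarrow> real" where
  "flip_coeff A U T = measure_pmf.expectation (pmf_of_set U)
     (\<lambda>b. (walsh A (insert b T) + walsh A (T - {b})) / 2)"

lemma abs_flip_coeff_le_1:
  assumes "finite U" "U \<noteq> {}"
  shows "\<bar>flip_coeff A U T\<bar> \<le> 1"
  unfolding flip_coeff_def
proof (rule abs_expectation_pmf_le_1)
  fix b
  have "\<bar>walsh A (insert b T) + walsh A (T - {b})\<bar> \<le> \<bar>walsh A (insert b T)\<bar> + \<bar>walsh A (T - {b})\<bar>"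
    by (rule abs_triangle_ineq)
  then show "\<bar>(walsh A (insert b T) + walsh A (T - {b})) / 2\<bar> \<le> 1" by simp
qed (use assms in simp)

text \<open>Every \<open>b\<close> in \<open>U\<close> lies in the support \<open>N\<close> of the
  character, so the two outcomes of the coin give opposite signs.\<close>

lemma flip_coeff_full:
  assumes "finite N" "U \<subseteq> N" "U \<noteq> {}"
  shows "flip_coeff N U T = 0"
proof -
  have "finite U" using assms finite_subset by blast
  then have "flip_coeff N U T = (\<Sum>b\<in>U. (walsh N (insert b T) + walsh N (T - {b})) / 2) / card U"
    unfolding flip_coeff_def using assms by (intro integral_pmf_of_set) auto
  also have "(\<Sum>b\<in>U. (walsh N (insert b T) + walsh N (T - {b})) / 2) = (\<Sum>b\<in>U. 0)"
    using assms by (intro sum.cong refl) (auto simp: walsh_insert)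
  finally show ?thesis by simp
qed

lemma layer_not_empty: "finite N \<Longrightarrow> s \<le> card N \<Longrightarrow> layer N s \<noteq> {}"
  by (metis card_layer card.empty binomial_eq_0_iff not_less)

text \<open>Given the switches, the bulb and coin of each modified stage are independent of those of
  the other and see only their own stage. The conditional mean is thus a product over stages, and
  independence of the stages takes the outer expectation inside.\<close>

lemma expectation_V_set_pmf:
  fixes m :: nat
  defines "n \<equiv> 2 * m + 1"
  assumes m: "1 \<le> m" and A: "A \<subseteq> {1..n}"
  shows "measure_pmf.expectation (V_set_pmf m) (walsh A)
    = (\<Prod>r\<in>{1..n}. measure_pmf.expectation (pmf_of_set (layer {1..n} r))
        (\<lambda>T. if r = m then flip_coeff A ({1..n} - T) T
             else if r = m + 1 then flip_coeff A T T else walsh A T))"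
    (is "_ = (\<Prod>r\<in>_. measure_pmf.expectation _ (?F r))")
proof -
  have sw: "switch_pmf n = Pi_pmf {1..n} {} (\<lambda>r. pmf_of_set (layer {1..n} r))"
    by (simp add: switch_pmf_def layer_def)
  have set_layer: "set_pmf (pmf_of_set (layer {1..n} r)) = layer {1..n} r" if "r \<in> {1..n}" for r
    using that by (intro set_pmf_of_set layer_not_empty finite_layer) auto
  have S: "S r \<in> layer {1..n} r" if "S \<in> set_pmf (switch_pmf n)" "r \<in> {1..n}" for S r
    using that set_layer[OF that(2)] unfolding sw by (auto simp: set_Pi_pmf PiE_dflt_def)
  have fin_S: "finite (set_pmf (switch_pmf n))"
    unfolding sw using set_layer finite_layer[of "{1..n}"]
    by (subst set_Pi_pmf) (auto intro!: finite_PiE_dflt)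
  have mn: "m \<in> {1..n}" "m + 1 \<in> {1..n}" using m by (auto simp: n_def)
  define inner where "inner S = do { b \<leftarrow> pmf_of_set ({1..n} - S m);
          b' \<leftarrow> pmf_of_set (S (m + 1));
          c \<leftarrow> bernoulli_pmf (1/2);
          c' \<leftarrow> bernoulli_pmf (1/2);
          return_pmf (bulb_set n (modify_switch m S b b' c c')) }" for S
  have inner: "measure_pmf.expectation (inner S) (walsh A) = (\<Prod>r\<in>{1..n}. ?F r (S r))"
    and fin_inner: "finite (set_pmf (inner S))"
    if "S \<in> set_pmf (switch_pmf n)" for S
  proof -
    have Sm: "S m \<subseteq> {1..n}" "card (S m) = m" and Sm': "S (m + 1) \<subseteq> {1..n}" "card (S (m + 1)) = m + 1"
      using S[OF that mn(1)] S[OF that mn(2)] by (auto simp: layer_def)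
    have U: "finite ({1..n} - S m)" "{1..n} - S m \<noteq> {}"
    proof -
      show "{1..n} - S m \<noteq> {}"
      proof
        assume "{1..n} - S m = {}"
        then have "S m = {1..n}" using Sm by auto
        then show False using Sm(2) by (simp add: n_def)
      qed
    qed simp
    have U': "finite (S (m + 1))" "S (m + 1) \<noteq> {}"
      using Sm' finite_subset by auto
    show "finite (set_pmf (inner S))"
      using U U' by (auto simp: inner_def)
    define K where "K = (\<Prod>r\<in>{1..n} - {m, m + 1}. walsh A (S r))"
    have split: "(\<Prod>r\<in>{1..n}. g r) = g m * (g (m + 1) * (\<Prod>r\<in>{1..n} - {m, m + 1}. g r))"
      for g :: "nat \<Rightarrow> real"
    proof -
      have "(\<Prod>r\<in>{1..n}. g r) = g m * (\<Prod>r\<in>{1..n} - {m}. g r)"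
        using mn by (intro prod.remove) auto
      also have "(\<Prod>r\<in>{1..n} - {m}. g r) = g (m + 1) * (\<Prod>r\<in>{1..n} - {m} - {m + 1}. g r)"
        using mn by (intro prod.remove) auto
      also have "{1..n} - {m} - {m + 1} = {1..n} - {m, m + 1}" by auto
      finally show ?thesis .
    qed
    have walsh_bulb: "walsh A (bulb_set n W) = (\<Prod>r\<in>{1..n}. walsh A (W r))" for W
    proof -
      have "walsh A (bulb_set n W) = walsh A {j. odd (card {r \<in> {1..n}. j \<in> W r})}"
        using A by (intro walsh_cong) (auto simp: bulb_set_def)
      then show ?thesis by (simp only: walsh_parity finite_atLeastAtMost)
    qed
    have walsh_mod: "walsh A (bulb_set n (modify_switch m S b b' c c'))
       = walsh A (if c then insert b (S m) else S m - {b}) *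
         (walsh A (if c' then insert b' (S (m + 1)) else S (m + 1) - {b'}) * K)" for b b' c c'
      unfolding walsh_bulb split K_def
      by (intro arg_cong2[where f = "(*)"] prod.cong refl) (auto simp: modify_switch_def)
    have coins: "measure_pmf.expectation (do { c \<leftarrow> bernoulli_pmf (1/2); c' \<leftarrow> bernoulli_pmf (1/2);
          return_pmf (bulb_set n (modify_switch m S b b' c c')) }) (walsh A)
       = (walsh A (insert b (S m)) + walsh A (S m - {b})) / 2 *
         ((walsh A (insert b' (S (m + 1))) + walsh A (S (m + 1) - {b'})) / 2 * K)" for b b'
      by (simp add: expectation_bind_pmf_finite walsh_mod) (simp add: field_simps)
    have "measure_pmf.expectation (inner S) (walsh A) =
       measure_pmf.expectation (pmf_of_set ({1..n} - S m)) (\<lambda>b.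
         measure_pmf.expectation (pmf_of_set (S (m + 1))) (\<lambda>b'.
           (walsh A (insert b (S m)) + walsh A (S m - {b})) / 2 *
           ((walsh A (insert b' (S (m + 1))) + walsh A (S (m + 1) - {b'})) / 2 * K)))"
      unfolding inner_def coins[symmetric] using U U'
      by (subst expectation_bind_pmf_finite; (subst expectation_bind_pmf_finite)?) auto
    also have "\<dots> = flip_coeff A ({1..n} - S m) (S m) * (flip_coeff A (S (m + 1)) (S (m + 1)) * K)"
      unfolding flip_coeff_def by simp
    also have "\<dots> = (\<Prod>r\<in>{1..n}. ?F r (S r))"
      unfolding split K_def by (intro arg_cong2[where f = "(*)"] prod.cong refl) auto
    finally show "measure_pmf.expectation (inner S) (walsh A) = (\<Prod>r\<in>{1..n}. ?F r (S r))" .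
  qed
  have "V_set_pmf m = bind_pmf (switch_pmf n) inner"
    by (simp add: V_set_pmf_def inner_def[abs_def] Let_def n_def)
  then have "measure_pmf.expectation (V_set_pmf m) (walsh A)
      = measure_pmf.expectation (switch_pmf n) (\<lambda>S. measure_pmf.expectation (inner S) (walsh A))"
    using fin_S fin_inner by (simp add: expectation_bind_pmf_finite)
  also have "\<dots> = measure_pmf.expectation (switch_pmf n) (\<lambda>S. \<Prod>r\<in>{1..n}. ?F r (S r))"
    using inner by (intro integral_cong_AE) (auto simp: AE_measure_pmf_iff)
  also have "\<dots> = (\<Prod>r\<in>{1..n}. measure_pmf.expectation (pmf_of_set (layer {1..n} r)) (?F r))"
    unfolding sw using set_layer finite_layer[of "{1..n}"]
    by (intro expectation_prod_Pi_pmf_finite) auto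
  finally show ?thesis .
qed

text \<open>The modified stages are bounded by 1, except that stage \<open>m\<close> annihilates the
  full character, a case outside the reach of \<open>abs_layer_coeff_le\<close>.\<close>

lemma abs_expectation_V_set_pmf_le:
  fixes m :: nat
  defines "n \<equiv> 2 * m + 1"
  assumes m: "1 \<le> m" and A: "A \<subseteq> {1..n}"
  shows "\<bar>measure_pmf.expectation (V_set_pmf m) (walsh A)\<bar>
    \<le> of_bool (A \<noteq> {1..n}) * (\<Prod>r\<in>{1..n} - {m, m + 1}. \<bar>layer_coeff {1..n} r A\<bar>)"
proof -
  let ?q = "\<lambda>r. pmf_of_set (layer {1..n} r)"
  let ?F = "\<lambda>r T. if r = m then flip_coeff A ({1..n} - T) T
             else if r = m + 1 then flip_coeff A T T else walsh A T"
  let ?e = "\<lambda>r. measure_pmf.expectation (?q r) (?F r)"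
  have ne: "layer {1..n} r \<noteq> {}" "finite (layer {1..n} r)" if "r \<le> n" for r
    using that layer_not_empty[of "{1..n}" r] finite_layer[of "{1..n}" r] by auto
  have mn: "m \<in> {1..n}" "m + 1 \<in> {1..n}" using m by (auto simp: n_def)
  have U: "finite ({1..n} - T)" "{1..n} - T \<noteq> {}" if "T \<in> layer {1..n} m" for T
  proof -
    show "{1..n} - T \<noteq> {}"
    proof
      assume "{1..n} - T = {}"
      then have "T = {1..n}" using that by (auto simp: layer_def)
      then show False using that by (simp add: n_def layer_def)
    qed
  qed simp
  have U': "finite T" "T \<noteq> {}" if "T \<in> layer {1..n} (m + 1)" for T
    using that finite_subset by (auto simp: layer_def)
  have le_1: "\<bar>?e m\<bar> \<le> 1" "\<bar>?e (m + 1)\<bar> \<le> 1"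
    using mn ne U U' U'(2)[of "{}"] by (auto intro!: abs_expectation_pmf_le_1 abs_flip_coeff_le_1)
  have full: "?e m = 0" if "A = {1..n}"
  proof -
    have "?e m = (\<Sum>T\<in>layer {1..n} m. flip_coeff {1..n} ({1..n} - T) T) / card (layer {1..n} m)"
      using ne[of m] that by (simp add: n_def integral_pmf_of_set)
    also have "(\<Sum>T\<in>layer {1..n} m. flip_coeff {1..n} ({1..n} - T) T) = (\<Sum>T\<in>layer {1..n} m. 0)"
      using U by (intro sum.cong refl flip_coeff_full) auto
    finally show ?thesis by simp
  qed
  have other: "?e r = layer_coeff {1..n} r A" if "r \<in> {1..n} - {m, m + 1}" for r
    using that ne[of r] by (auto simp: layer_coeff_def integral_pmf_of_set card_layer)
  have "measure_pmf.expectation (V_set_pmf m) (walsh A) = (\<Prod>r\<in>{1..n}. ?e r)"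
    unfolding n_def by (rule expectation_V_set_pmf[OF m A[unfolded n_def]])
  also have "\<dots> = ?e m * (\<Prod>r\<in>{1..n} - {m}. ?e r)"
    using mn by (intro prod.remove) auto
  also have "(\<Prod>r\<in>{1..n} - {m}. ?e r) = ?e (m + 1) * (\<Prod>r\<in>{1..n} - {m} - {m + 1}. ?e r)"
    using mn by (intro prod.remove) auto
  also have "(\<Prod>r\<in>{1..n} - {m} - {m + 1}. ?e r) = (\<Prod>r\<in>{1..n} - {m, m + 1}. layer_coeff {1..n} r A)"
    by (intro prod.cong other) auto
  finally have eq: "measure_pmf.expectation (V_set_pmf m) (walsh A)
    = ?e m * (?e (m + 1) * (\<Prod>r\<in>{1..n} - {m, m + 1}. layer_coeff {1..n} r A))" .
  show ?thesis
  proof (cases "A = {1..n}")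
    case True
    then show ?thesis unfolding eq full[OF True] by simp
  next
    case False
    have "\<bar>?e m\<bar> * \<bar>?e (m + 1)\<bar> \<le> 1 * 1" using le_1 by (intro mult_mono) auto
    then have "(\<bar>?e m\<bar> * \<bar>?e (m + 1)\<bar>) * (\<Prod>r\<in>{1..n} - {m, m + 1}. \<bar>layer_coeff {1..n} r A\<bar>)
       \<le> 1 * (\<Prod>r\<in>{1..n} - {m, m + 1}. \<bar>layer_coeff {1..n} r A\<bar>)"
      by (intro mult_right_mono prod_nonneg) auto
    then show ?thesis unfolding eq abs_mult abs_prod using False by (simp add: mult.assoc)
  qed
qed

section \<open>Total variation distance from the lit set to a uniform random set\<close>

lemma sum_mult_diff:
  "(\<Sum>r=1..k. real r * (c - real r)) = c * (real k * (real k + 1)) / 2 - real k * (real k + 1) * (2 * real k + 1) / 6"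
  by (induction k) (auto simp: field_simps)

text \<open>Two factors of each coefficient are kept for Parseval, so that summing over all
  characters costs only \<open>2 * (n + 1)\<close>. The factors in \<open>J\<close> are at most
  \<open>exp (- a r)\<close>, uniformly in the character.\<close>

lemma V_set_pmf_dist_uniform_le:
  fixes m :: nat
  defines "n \<equiv> 2 * m + 1"
  assumes m: "3 \<le> m"
  shows "\<bar>measure_pmf.prob (V_set_pmf m) E - card (E \<inter> Pow {1..n}) / 2 ^ n\<bar>
    \<le> 2 * (real n + 1) * exp (3 - (real n + 1) / 3)"
proof -
  let ?N = "{1..n}"
  let ?lc = "\<lambda>r A. layer_coeff ?N r A"
  define a where "a r = 2 * (real r * (real n - real r)) / (real n * (real n - 1))" for r
  define J where "J = ?N - {m - 1, m, m + 1, m + 2}"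
  have n7: "real n \<ge> 7" using m by (simp add: n_def)
  \<comment> \<open>With this bound, omitting the four middle stages lowers the exponent
    \<open>(n + 1) / 3\<close> by at most 3.\<close>
  have a_max: "a r \<le> 3 / 4" for r
  proof -
    have "4 * (real r * (real n - real r)) \<le> (real n)\<^sup>2"
      using zero_le_power2[of "real n - 2 * real r"] by (simp add: power2_eq_square algebra_simps)
    also have "\<dots> \<le> 3 / 2 * (real n * (real n - 1))"
      using mult_nonneg_nonneg[of "real n" "real n - 3"] n7 by (simp add: power2_eq_square algebra_simps)
    finally show ?thesis using n7 by (simp add: a_def field_simps)
  qed
  have "(\<Sum>r\<in>?N. a r) = 2 / (real n * (real n - 1)) * (\<Sum>r=1..n. real r * (real n - real r))"
    by (simp add: a_def sum_distrib_left)
  also have "(\<Sum>r=1..n. real r * (real n - real r)) = real n * (real n - 1) * (real n + 1) / 6"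
    unfolding sum_mult_diff by (simp add: field_simps)
  also have "2 / (real n * (real n - 1)) * (real n * (real n - 1) * (real n + 1) / 6) = (real n + 1) / 3"
    using n7 by simp
  finally have a_sum: "(\<Sum>r\<in>?N. a r) = (real n + 1) / 3" .
  have J_sub: "{m - 1, m, m + 1, m + 2} \<subseteq> ?N" using m by (auto simp: n_def)
  have "(\<Sum>r\<in>{m - 1, m, m + 1, m + 2}. a r) \<le> (\<Sum>r\<in>{m - 1, m, m + 1, m + 2}. 3 / 4)"
    by (intro sum_mono a_max)
  also have "\<dots> \<le> 3" using m by (simp add: card_insert_if)
  finally have a_J: "(\<Sum>r\<in>J. a r) \<ge> (real n + 1) / 3 - 3"
    unfolding J_def sum_diff[OF finite_atLeastAtMost J_sub] a_sum by simp
  have J_prod: "(\<Prod>r\<in>J. \<bar>?lc r A\<bar>) \<le> exp (3 - (real n + 1) / 3)"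
    if "A \<in> Pow ?N - {{}, ?N}" for A
  proof -
    have "(\<Prod>r\<in>J. \<bar>?lc r A\<bar>) \<le> (\<Prod>r\<in>J. exp (- a r))"
    proof (intro prod_mono conjI)
      fix r assume "r \<in> J"
      then have r: "1 \<le> r" "r \<le> n" by (auto simp: J_def)
      have "\<bar>?lc r A\<bar> \<le> 1 - a r"
        using abs_layer_coeff_le[of ?N A r] that r by (auto simp: a_def)
      also have "\<dots> \<le> exp (- a r)" using exp_ge_add_one_self[of "- a r"] by simp
      finally show "\<bar>?lc r A\<bar> \<le> exp (- a r)" .
    qed simp
    also have "\<dots> = exp (- (\<Sum>r\<in>J. a r))"
      by (simp add: exp_sum J_def sum_negf[symmetric] del: sum_negf)
    also have "\<dots> \<le> exp (3 - (real n + 1) / 3)" using a_J by simp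
    finally show ?thesis .
  qed
  \<comment> \<open>The quotient of the two coefficients is \<open>(m + 2) / m\<close>. The central
    coefficient is in turn at least the average \<open>2 ^ n / (n + 1)\<close>.\<close>
  have "real (n choose m) \<le> 2 * real (n choose (m - 1))"
  proof -
    obtain k where k: "m = Suc k" using m by (metis Suc_le_D eval_nat_numeral(3))
    have "Suc k * (n choose Suc k) = (n - k) * (n choose k)"
      using binomial_absorption[of k n] binomial_absorb_comp[of n k] by simp
    also have "\<dots> \<le> (Suc k * 2) * (n choose k)"
      using m by (intro mult_right_mono) (auto simp: n_def k)
    finally have "n choose m \<le> 2 * (n choose (m - 1))"
      unfolding k mult.assoc Suc_mult_le_cancel1 by simp
    then show ?thesis by (metis of_nat_le_iff of_nat_mult of_nat_numeral)
  qed
  moreover have "2 ^ n \<le> (real n + 1) * real (n choose m)"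
  proof -
    have "(2::nat) ^ n = (\<Sum>k\<le>n. n choose k)" by (simp add: choose_row_sum)
    also have "\<dots> \<le> (\<Sum>k\<le>n. n choose m)"
      using binomial_maximum[of n] by (intro sum_mono) (simp add: n_def)
    also have "\<dots> = (n + 1) * (n choose m)" by simp
    finally have "real (2 ^ n) \<le> real ((n + 1) * (n choose m))" by (simp only: of_nat_le_iff)
    then show ?thesis by (simp add: algebra_simps)
  qed
  ultimately have "2 ^ n \<le> (real n + 1) * (2 * real (n choose (m - 1)))"
    by (smt (verit) mult_left_mono of_nat_0_le_iff)
  moreover have C0: "real (n choose (m - 1)) > 0" using m by (simp add: n_def)
  ultimately have C_le: "2 ^ n / real (n choose (m - 1)) \<le> 2 * (real n + 1)"
    by (simp add: field_simps)
  \<comment> \<open>The stages \<open>m - 1\<close> and \<open>m + 2\<close> are complementary, so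
    their Parseval sums are equal.\<close>
  have C_sym: "n choose (m + 2) = n choose (m - 1)"
    using binomial_symmetric[of "m + 2" n] m by (simp add: n_def)
  \<comment> \<open>The inequality of arithmetic and geometric means splits the mixed sum into two
    Parseval sums.\<close>
  have "(\<Sum>A\<in>Pow ?N. \<bar>?lc (m - 1) A\<bar> * \<bar>?lc (m + 2) A\<bar>)
      \<le> (\<Sum>A\<in>Pow ?N. ((?lc (m - 1) A)\<^sup>2 + (?lc (m + 2) A)\<^sup>2) / 2)"
  proof (rule sum_mono)
    fix A
    show "\<bar>?lc (m - 1) A\<bar> * \<bar>?lc (m + 2) A\<bar> \<le> ((?lc (m - 1) A)\<^sup>2 + (?lc (m + 2) A)\<^sup>2) / 2"
      using zero_le_power2[of "\<bar>?lc (m - 1) A\<bar> - \<bar>?lc (m + 2) A\<bar>"] by (simp add: power2_diff)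
  qed
  also have "\<dots> = ((\<Sum>A\<in>Pow ?N. (?lc (m - 1) A)\<^sup>2) + (\<Sum>A\<in>Pow ?N. (?lc (m + 2) A)\<^sup>2)) / 2"
    by (simp only: sum.distrib sum_divide_distrib[symmetric])
  also have "\<dots> = 2 ^ n / real (n choose (m - 1))"
  proof -
    have "m - 1 \<le> card ?N" "m + 2 \<le> card ?N" using m by (auto simp: n_def)
    from this[THEN parseval_layer[OF finite_atLeastAtMost]] show ?thesis
      by (simp add: C_sym del: binomial_Suc_Suc add_2_eq_Suc')
  qed
  finally have cs: "(\<Sum>A\<in>Pow ?N. \<bar>?lc (m - 1) A\<bar> * \<bar>?lc (m + 2) A\<bar>) \<le> 2 * (real n + 1)"
    using C_le by simp
  have term_le: "\<bar>measure_pmf.expectation (V_set_pmf m) (walsh A)\<bar>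
     \<le> \<bar>?lc (m - 1) A\<bar> * \<bar>?lc (m + 2) A\<bar> * exp (3 - (real n + 1) / 3)"
    if "A \<in> Pow ?N - {{}}" for A
  proof (cases "A = ?N")
    case True
    then show ?thesis
      using abs_expectation_V_set_pmf_le[of m A] that m by (simp add: n_def)
  next
    case False
    have "\<bar>measure_pmf.expectation (V_set_pmf m) (walsh A)\<bar>
       \<le> (\<Prod>r\<in>?N - {m, m + 1}. \<bar>?lc r A\<bar>)"
      using abs_expectation_V_set_pmf_le[of m A] that m False unfolding n_def by auto
    also have "\<dots> = (\<Prod>r\<in>insert (m - 1) (insert (m + 2) J). \<bar>?lc r A\<bar>)"
    proof (rule prod.cong)
      show "?N - {m, m + 1} = insert (m - 1) (insert (m + 2) J)"
        unfolding J_def using J_sub m by auto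
    qed simp
    also have "\<dots> = \<bar>?lc (m - 1) A\<bar> * (\<bar>?lc (m + 2) A\<bar> * (\<Prod>r\<in>J. \<bar>?lc r A\<bar>))"
      using m by (subst prod.insert, simp_all add: J_def)+
    also have "\<dots> \<le> \<bar>?lc (m - 1) A\<bar> * (\<bar>?lc (m + 2) A\<bar> * exp (3 - (real n + 1) / 3))"
      using J_prod[of A] that False by (intro mult_left_mono) auto
    finally show ?thesis by (simp only: mult.assoc)
  qed
  have "\<bar>measure_pmf.prob (V_set_pmf m) E - card (E \<inter> Pow ?N) / 2 ^ card ?N\<bar>
    \<le> (\<Sum>A\<in>Pow ?N - {{}}. \<bar>measure_pmf.expectation (V_set_pmf m) (walsh A)\<bar>)"
    using set_V_set_pmf[of m] by (intro pmf_dist_uniform_le) (auto simp: n_def)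
  also have "\<dots> \<le> (\<Sum>A\<in>Pow ?N - {{}}. \<bar>?lc (m - 1) A\<bar> * \<bar>?lc (m + 2) A\<bar> * exp (3 - (real n + 1) / 3))"
    by (rule sum_mono) (rule term_le)
  also have "\<dots> \<le> (\<Sum>A\<in>Pow ?N. \<bar>?lc (m - 1) A\<bar> * \<bar>?lc (m + 2) A\<bar> * exp (3 - (real n + 1) / 3))"
    by (rule sum_mono2) auto
  also have "\<dots> = (\<Sum>A\<in>Pow ?N. \<bar>?lc (m - 1) A\<bar> * \<bar>?lc (m + 2) A\<bar>) * exp (3 - (real n + 1) / 3)"
    by (simp only: sum_distrib_right)
  also have "\<dots> \<le> 2 * (real n + 1) * exp (3 - (real n + 1) / 3)"
    using cs by (intro mult_right_mono) auto
  finally show ?thesis by simp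
qed

lemma card_Pow_filter_card:
  assumes "finite N"
  shows "real (card ({T. P (card T)} \<inter> Pow N)) = (\<Sum>k\<le>card N. real (card N choose k) * of_bool (P k))"
proof -
  have "real (card ({T. P (card T)} \<inter> Pow N)) = (\<Sum>T\<in>Pow N. of_bool (P (card T)))"
    using assms by (simp add: of_bool_def sum.If_cases Int_commute)
  also have "\<dots> = (\<Sum>k\<le>card N. \<Sum>T\<in>{T \<in> Pow N. card T = k}. of_bool (P (card T)))"
    using assms by (intro sum.group[symmetric]) (auto intro: card_mono)
  also have "\<dots> = (\<Sum>k\<le>card N. real (card (layer N k)) * of_bool (P k))"
    by (intro sum.cong refl) (auto simp: layer_def)
  finally show ?thesis using assms by (simp add: card_layer)
qed

text \<open>Triangle inequality through the uniform random set, whose size is symmetric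
  binomial.\<close>

lemma V_pmf_berry_esseen:
  fixes m :: nat
  defines "n \<equiv> 2 * m + 1"
  assumes m: "3 \<le> m"
  shows "\<bar>measure_pmf.prob (V_pmf m) {v. (2 * real v - real n) / sqrt n \<le> z} - Phi z\<bar>
    \<le> 3 / (2 * sqrt n) + 2 * (real n + 1) * exp (3 - (real n + 1) / 3)"
proof -
  let ?P = "\<lambda>v::nat. (2 * real v - real n) / sqrt n \<le> z"
  have "real (card ({T. ?P (card T)} \<inter> Pow {1..n})) / 2 ^ n
      = (\<Sum>k\<le>n. real (n choose k) / 2 ^ n * of_bool (?P k))"
  proof -
    have "real (card ({T. ?P (card T)} \<inter> Pow {1..n})) = (\<Sum>k\<le>n. real (n choose k) * of_bool (?P k))"
      using card_Pow_filter_card[of "{1..n}" ?P] by simp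
    then show ?thesis by (simp only: sum_divide_distrib times_divide_eq_left)
  qed
  moreover have "measure_pmf.prob (V_pmf m) {v. ?P v} = measure_pmf.prob (V_set_pmf m) {T. ?P (card T)}"
    by (simp add: V_pmf_eq_map vimage_def)
  ultimately show ?thesis
    using V_set_pmf_dist_uniform_le[OF m, of "{T. ?P (card T)}"]
      berry_esseen_symmetric_binomial[of n m z] unfolding n_def by linarith
qed

subsection \<open>The variance parameter\<close>

lemma lam_2:
  assumes "2 \<le> n"
  shows "lam n 2 s = 1 - 4 * (real s * (real n - real s)) / (real n * (real n - 1))"
proof -
  have "lam n 2 s = 1 - 4 * real s / real n + 4 * (real s * (real s - 1)) / (real n * (real n - 1))"
    by (simp add: lam_def ffall_def numeral_2_eq_2 lessThan_Suc mult_ac)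
  also have "\<dots> = 1 - 4 * (real s * (real n - real s)) / (real n * (real n - 1))"
    using assms by (simp add: divide_simps) (simp add: algebra_simps)
  finally show ?thesis .
qed

lemma abs_lam_2_le_1:
  assumes "2 \<le> n" "s \<le> n"
  shows "\<bar>lam n 2 s\<bar> \<le> 1"
proof -
  have "4 * (real s * (real n - real s)) \<le> (real n)\<^sup>2"
    using zero_le_power2[of "real n - 2 * real s"] by (simp add: power2_eq_square algebra_simps)
  also have "\<dots> \<le> 2 * (real n * (real n - 1))"
    using mult_nonneg_nonneg[of "real n" "real n - 2"] assms by (simp add: power2_eq_square algebra_simps)
  finally have "4 * (real s * (real n - real s)) / (real n * (real n - 1)) \<le> 2"
    using assms by (simp add: field_simps)
  moreover have "0 \<le> 4 * (real s * (real n - real s)) / (real n * (real n - 1))"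
    using assms by (intro divide_nonneg_nonneg mult_nonneg_nonneg) auto
  ultimately show ?thesis unfolding lam_2[OF assms(1)] by linarith
qed

text \<open>Since \<open>4 * m * (m + 1) = n\<^sup>2 - 1\<close>, the fraction in
  \<open>lam_2\<close> equals \<open>(n + 1) / n\<close>.\<close>

lemma lam_2_middle:
  assumes "n = 2 * m + 1" "1 \<le> m"
  shows "lam n 2 m = - 1 / real n" "lam n 2 (m + 1) = - 1 / real n"
  using assms by (auto simp: lam_2 divide_simps)

text \<open>The squared middle factor is exactly \<open>1 / n\<^sup>2\<close> and all others have
  modulus at most 1. Hence the variance is \<open>n / 4\<close> up to a relative error below
  \<open>1 / n\<close>.\<close>

lemma abs_lam_bar_le:
  assumes "n = 2 * m + 1" "1 \<le> m"
  shows "\<bar>lam_bar n m\<bar> \<le> 1 / (real n)\<^sup>2"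
proof -
  have "\<bar>\<Prod>s\<in>{1..n} - {m, m + 1}. lam n 2 s\<bar> \<le> 1"
    unfolding abs_prod using assms by (intro prod_le_1) (auto intro: abs_lam_2_le_1)
  then have "\<bar>\<Prod>s\<in>{1..n} - {m, m + 1}. lam n 2 s\<bar> * (1 / (real n)\<^sup>2) \<le> 1 * (1 / (real n)\<^sup>2)"
    by (intro mult_right_mono) auto
  moreover have "((lam n 2 m + lam n 2 (m + 1)) / 2)\<^sup>2 = 1 / (real n)\<^sup>2"
    unfolding lam_2_middle[OF assms] by (simp add: power_divide)
  ultimately show ?thesis
    by (simp only: lam_bar_def abs_mult abs_divide power2_abs abs_one abs_power2)
qed

text \<open>Mean value theorem: since \<open>\<rho> \<ge> 1 / 2\<close>, the intermediate point
  satisfies \<open>\<bar>z\<bar> \<le> 2 * \<bar>x\<bar>\<close>, so the density absorbs the factor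
  \<open>\<bar>z\<bar>\<close> in the interval length.\<close>

lemma Phi_scale_le:
  assumes "\<bar>\<rho> - 1\<bar> \<le> 1 / 2"
  shows "\<bar>Phi (\<rho> * z) - Phi z\<bar> \<le> 2 * \<bar>\<rho> - 1\<bar>"
proof (cases "\<rho> * z = z")
  case False
  have \<rho>: "1 / 2 \<le> \<rho>" using assms by linarith
  define u v where "u = min z (\<rho> * z)" and "v = max z (\<rho> * z)"
  have "u < v" unfolding u_def v_def using False by linarith
  then obtain x where x: "u < x" "x < v" "Phi v - Phi u = (v - u) * std_normal_density x"
    using MVT2[of u v Phi std_normal_density] Phi_has_real_derivative by blast
  have "\<bar>z\<bar> \<le> 2 * \<bar>x\<bar>"
  proof (cases "z \<ge> 0")
    case True
    then have "1 / 2 * z \<le> \<rho> * z" using \<rho> by (intro mult_right_mono) auto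
    then show ?thesis using x True by (auto simp: u_def v_def)
  next
    case False
    then have "\<rho> * z \<le> 1 / 2 * z" using \<rho> False by (intro mult_right_mono_neg) auto
    then show ?thesis using x(1,2) False unfolding u_def v_def by linarith
  qed
  then have "\<bar>z\<bar> * std_normal_density x \<le> 2 * (\<bar>x\<bar> * std_normal_density x)"
    using std_normal_density_pos[of x] by (simp flip: mult.assoc add: mult_right_mono)
  also have "\<bar>x\<bar> * std_normal_density x \<le> 1"
  proof -
    have "\<bar>x\<bar> \<le> 1 + x\<^sup>2 / 2"
      using zero_le_power2[of "\<bar>x\<bar> - 1"] by (simp add: power2_diff)
    also have "\<dots> \<le> exp (x\<^sup>2 / 2)" by (rule exp_ge_add_one_self)
    finally have "\<bar>x\<bar> * exp (- x\<^sup>2 / 2) \<le> 1" by (simp add: exp_minus field_simps)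
    moreover have "1 / sqrt (2 * pi) \<le> 1" using pi_ge_two by (simp add: divide_le_eq)
    ultimately have "1 / sqrt (2 * pi) * (\<bar>x\<bar> * exp (- x\<^sup>2 / 2)) \<le> 1 * 1"
      by (intro mult_mono) auto
    then show ?thesis by (simp add: std_normal_density_def)
  qed
  finally have "\<bar>z\<bar> * std_normal_density x \<le> 2" by simp
  then have "\<bar>\<rho> - 1\<bar> * (\<bar>z\<bar> * std_normal_density x) \<le> \<bar>\<rho> - 1\<bar> * 2"
    by (intro mult_left_mono) auto
  moreover have "v - u = \<bar>\<rho> - 1\<bar> * \<bar>z\<bar>"
  proof -
    have "\<rho> * z - z = (\<rho> - 1) * z" by (simp add: algebra_simps)
    then have "\<bar>\<rho> * z - z\<bar> = \<bar>\<rho> - 1\<bar> * \<bar>z\<bar>" by (simp add: abs_mult)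
    then show ?thesis by (auto simp: u_def v_def)
  qed
  ultimately have "\<bar>Phi v - Phi u\<bar> \<le> 2 * \<bar>\<rho> - 1\<bar>"
    using x(3) std_normal_density_pos[of x] by (simp add: abs_mult mult_ac)
  then show ?thesis by (auto simp: u_def v_def min_def max_def split: if_splits)
qed auto

lemma tail_le_inverse:
  fixes x :: real
  assumes "100 \<le> x"
  shows "2 * (x + 1) * exp (3 - (x + 1) / 3) \<le> 1 / x"
proof -
  have e3: "exp (3::real) \<le> 27"
  proof -
    have "exp (3::real) = exp 1 ^ 3" by (simp flip: exp_of_nat_mult)
    also have "\<dots> \<le> 3 ^ 3" using exp_le by (intro power_mono) auto
    finally show ?thesis by simp
  qed
  \<comment> \<open>The 55 comes from \<open>2 * 27 * (x + 1) \<le> 55 * x\<close>. Of twelve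
    factors \<open>1 + x / 36\<close>, ten are at least 3.7 as \<open>x \<ge> 100\<close>, and two
    retain the growth in \<open>x\<close>.\<close>
  have "55 * x\<^sup>2 \<le> (37 / 10) ^ 10 * (x / 36)\<^sup>2"
    by (simp add: power_divide field_simps)
  also have "\<dots> \<le> (1 + x / 36) ^ 10 * (1 + x / 36)\<^sup>2"
    using assms by (intro mult_mono power_mono) auto
  also have "\<dots> = (1 + (x / 3) / real 12) ^ 12"
    by (simp flip: power_add)
  also have "\<dots> \<le> exp (x / 3)"
    using assms by (intro exp_ge_one_plus_x_over_n_power_n) auto
  also have "\<dots> \<le> exp ((x + 1) / 3)" by simp
  finally have big: "55 * x\<^sup>2 \<le> exp ((x + 1) / 3)" .
  have "2 * (x + 1) * exp 3 * x \<le> 2 * (x + 1) * 27 * x"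
    using assms e3 by (intro mult_right_mono mult_left_mono) auto
  also have "\<dots> \<le> 55 * x\<^sup>2"
    using mult_nonneg_nonneg[of x "x - 54"] assms by (simp add: power2_eq_square algebra_simps)
  also note big
  finally have "2 * (x + 1) * (exp 3 / exp ((x + 1) / 3)) * x \<le> 1"
    by (simp add: divide_le_eq)
  then show ?thesis unfolding exp_diff using assms by (simp add: pos_le_divide_eq)
qed

section \<open>Assembling the bound for small and large \<open>n\<close>\<close>

theorem theorem3p3:
  fixes n m :: nat
  assumes "n = 2 * m + 1" and "n \<ge> 7"
  shows "(SUP z::real. \<bar>measure_pmf.prob (V_pmf m)
              {v. (real v - real n / 2) / sigmaV n m \<le> z} - Phi z\<bar>)
         \<le> real n / (2 * (sigmaV n m)^2) * Delta1_bar n + 1.64 * real n / (sigmaV n m)^3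
            + 2 / sigmaV n m"
proof -
  define s where "s = sigmaV n m"
  \<comment> \<open>The relative deviation of the variance from \<open>n / 4\<close>; below,
    \<open>\<rho>\<close> is the ratio of \<open>s\<close> to the binomial standard deviation
    \<open>sqrt n / 2\<close>.\<close>
  define L where "L = (real n - 1) * lam_bar n m"
  have m: "3 \<le> m" and n7: "real n \<ge> 7" using assms by auto
  have L_le: "\<bar>L\<bar> \<le> 1 / real n"
  proof -
    have "\<bar>L\<bar> \<le> (real n - 1) * (1 / (real n)\<^sup>2)"
      unfolding L_def abs_mult using abs_lam_bar_le[OF assms(1)] m n7 by (intro mult_mono) auto
    also have "\<dots> \<le> 1 / real n" using n7 by (simp add: field_simps power2_eq_square)
    finally show ?thesis .
  qed
  also have "1 / real n \<le> 1 / 7" using n7 by (simp add: field_simps)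
  finally have L7: "\<bar>L\<bar> \<le> 1 / 7" .
  define \<rho> where "\<rho> = sqrt (1 + L)"
  have \<rho>0: "0 < \<rho>" using L7 by (simp add: \<rho>_def abs_le_iff)
  have s_eq: "s = sqrt n / 2 * \<rho>"
  proof -
    have "real n / 4 * (1 - lam_bar n m) + (real n)\<^sup>2 / 4 * lam_bar n m = (real n / 4) * (1 + L)"
      by (simp add: L_def power2_eq_square field_simps)
    then have "s = sqrt (real n / 4 * (1 + L))" by (simp only: s_def sigmaV_def)
    then show ?thesis by (simp add: \<rho>_def real_sqrt_mult real_sqrt_divide)
  qed
  have s0: "0 < s" using \<rho>0 n7 by (simp add: s_eq)
  have s_sq: "s\<^sup>2 \<le> (real n + 1) / 4"
  proof -
    have "s\<^sup>2 = real n / 4 * (1 + L)"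
      using L7 by (simp add: s_eq \<rho>_def power_mult_distrib power_divide abs_le_iff)
    also have "\<dots> \<le> real n / 4 * (1 + 1 / real n)"
      using L_le by (intro mult_left_mono) auto
    also have "\<dots> = (real n + 1) / 4" using n7 by (simp add: field_simps)
    finally show ?thesis .
  qed
  have first: "0 \<le> real n / (2 * s\<^sup>2) * Delta1_bar n"
    by (auto simp: Delta1_bar_def)
  have "\<bar>measure_pmf.prob (V_pmf m) {v. (real v - real n / 2) / s \<le> z} - Phi z\<bar>
      \<le> real n / (2 * s\<^sup>2) * Delta1_bar n + 1.64 * real n / s ^ 3 + 2 / s" for z
  proof (cases "n \<le> 100")
    case True
    have "(s ^ 3)\<^sup>2 = (s\<^sup>2) ^ 3" by (simp flip: power_mult)
    also have "\<dots> \<le> ((real n + 1) / 4) ^ 3" using s_sq by (intro power_mono) auto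
    also have "\<dots> = (real n + 1)\<^sup>2 * (real n + 1) / 64" by (simp add: power_divide power3_eq_cube power2_eq_square)
    \<comment> \<open>From \<open>7 \<le> n \<le> 100\<close>: two factors \<open>n + 1\<close> are
      at most \<open>8 / 7 * n\<close> and the third at most 101. The resulting constant
      \<open>101 / 49\<close> is below the square of 1.64.\<close>
    also have "\<dots> \<le> (8 / 7 * real n)\<^sup>2 * 101 / 64"
      using True n7 by (intro divide_right_mono mult_mono power_mono) auto
    also have "\<dots> \<le> (1.64 * real n)\<^sup>2" by (simp add: power_mult_distrib power_divide)
    finally have "s ^ 3 \<le> 1.64 * real n" by (rule power2_le_imp_le) simp
    then have "1 \<le> 1.64 * real n / s ^ 3" using s0 by (simp add: field_simps)
    moreover have "\<bar>measure_pmf.prob (V_pmf m) {v. (real v - real n / 2) / s \<le> z} - Phi z\<bar> \<le> 1"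
      using Phi_nonneg[of z] Phi_le_1[of z]
        measure_pmf.prob_le_1[of "V_pmf m" "{v. (real v - real n / 2) / s \<le> z}"]
        measure_nonneg[of "measure_pmf (V_pmf m)" "{v. (real v - real n / 2) / s \<le> z}"] by linarith
    moreover have "0 \<le> 2 / s" using s0 by simp
    ultimately show ?thesis using first by linarith
  next
    case False
    then have n100: "real n \<ge> 100" by simp
    \<comment> \<open>Standardising by \<open>s\<close> means evaluating the binomial comparison at
      \<open>\<rho> * z\<close>; \<open>Phi_scale_le\<close> then pays for the return to
      \<open>z\<close>.\<close>
    have "(real v - real n / 2) / s \<le> z \<longleftrightarrow> (2 * real v - real n) / sqrt n \<le> \<rho> * z" for v :: nat
    proof -
      have "(real v - real n / 2) / s = (2 * real v - real n) / sqrt n / \<rho>"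
        using n7 \<rho>0 by (simp add: s_eq field_simps)
      then show ?thesis by (simp only: pos_divide_le_eq[OF \<rho>0] mult.commute)
    qed
    then have "\<bar>measure_pmf.prob (V_pmf m) {v. (real v - real n / 2) / s \<le> z} - Phi (\<rho> * z)\<bar>
       \<le> 3 / (2 * sqrt n) + 2 * (real n + 1) * exp (3 - (real n + 1) / 3)"
      using V_pmf_berry_esseen[OF m, of "\<rho> * z"] unfolding assms(1) by simp
    also have "\<dots> \<le> 3 / (2 * sqrt n) + 1 / real n"
      using n100 by (intro add_left_mono tail_le_inverse)
    finally have shape: "\<bar>measure_pmf.prob (V_pmf m) {v. (real v - real n / 2) / s \<le> z} - Phi (\<rho> * z)\<bar>
       \<le> 3 / (2 * sqrt n) + 1 / real n" .
    have \<rho>1: "\<bar>\<rho> - 1\<bar> \<le> \<bar>L\<bar>"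
    proof -
      have "L = (\<rho> - 1) * (\<rho> + 1)"
        using L7 by (simp add: \<rho>_def algebra_simps abs_le_iff)
      then have "\<bar>L\<bar> = \<bar>\<rho> - 1\<bar> * (\<rho> + 1)" using \<rho>0 by (simp add: abs_mult)
      then show ?thesis using mult_left_mono[of 1 "\<rho> + 1" "\<bar>\<rho> - 1\<bar>"] \<rho>0 by simp
    qed
    have "\<bar>Phi (\<rho> * z) - Phi z\<bar> \<le> 2 * \<bar>\<rho> - 1\<bar>"
      using \<rho>1 L7 by (intro Phi_scale_le) auto
    also have "\<dots> \<le> 2 * (1 / real n)" using \<rho>1 L_le by (intro mult_left_mono) auto
    finally have "\<bar>measure_pmf.prob (V_pmf m) {v. (real v - real n / 2) / s \<le> z} - Phi z\<bar>
       \<le> 3 / (2 * sqrt n) + 3 * (1 / real n)"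
      using shape by argo
    \<comment> \<open>As \<open>sqrt n \<ge> 10\<close>, the total coefficient of
      \<open>1 / sqrt n\<close> is \<open>3 / 2 + 3 / 10\<close>, which is below 2.\<close>
    also have "3 * (1 / real n) \<le> 3 / (10 * sqrt n)"
    proof -
      have "10 = sqrt 100" by simp
      also have "\<dots> \<le> sqrt n" using n100 by (intro real_sqrt_le_mono) simp
      finally have "10 * sqrt n \<le> sqrt n * sqrt n" by (intro mult_right_mono) auto
      then have "10 * sqrt n \<le> real n" by simp
      then show ?thesis using n100 by (simp add: frac_le)
    qed
    also have "3 / (2 * sqrt n) + 3 / (10 * sqrt n) \<le> 2 / sqrt n"
      using n100 by (simp add: field_simps)
    also have "2 / sqrt n \<le> 2 / s"
    proof -
      have "s\<^sup>2 \<le> (sqrt n)\<^sup>2" using s_sq n100 by simp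
      then have "s \<le> sqrt n" by (rule power2_le_imp_le) simp
      then show ?thesis using s0 n100 by (intro divide_left_mono mult_pos_pos) auto
    qed
    finally show ?thesis
      using first s0 by (smt (verit) divide_nonneg_pos of_nat_0_le_iff zero_less_power mult_nonneg_nonneg)
  qed
  then show ?thesis unfolding s_def by (intro cSUP_least) auto
qed

end
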